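(* Let $K$ be a compact space and $\mathfrak{s}=(r_s)_{s\in\Gamma}$ be a retractional skeleton on $K$. Then the following conditions are equivalent. (i) $D(\mathfrak{s})$ is induced by a commutative retractional skeleton (on $K$). (ii) There exists a subskeleton of $\mathfrak{s}$ which is commutative. (iii) There exist a subskeleton $\mathfrak{s}_2=(r_s)_{s\in\Gamma'}$ of $\mathfrak{s}$ and a dense (in $K$) set $D\subset D(\mathfrak{s})$ such that for every up-directed set $\Gamma''\subset\Gamma'$ and every $x\in D$ we have $\lim_{s\in\Gamma''}r_s(x)\in D$. Moreover, if $\lambda\ge 1$ and $\mathcal{A}\subset\lambda B_{\mathcal{C}(K)}$ is a closed, symmetric and convex set separating the points of $K$ such that $f\circ r_s\in\mathcal{A}$ for every $f\in\mathcal{A}$ and $s\in\Gamma$, then these conditions are also equivalent to the following one. (iv) There exists $\mathcal{H}\subset\mathcal{A}$ such that the mapping $\varphi:K\to[-1,1]^{\mathcal{H}}$ defined by $\varphi(x)(h):=\tfrac{1}{\lambda}h(x)$, for every $h\in\mathcal{H}$ and $x\in K$, is a homeomorphic embedding and $\varphi[D(\mathfrak{s})]\subset\Sigma(\mathcal{H})$.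
   Context: All topological spaces are Tychonoff (in particular Hausdorff). $\mathcal{C}(K)$ is the Banach space of real-valued continuous functions on $K$ with the supremum norm, and $B_{\mathcal{C}(K)}$ is its closed unit ball. For a set $I$, $\Sigma(I)=\{x\in\mathbb{R}^I: \{i\in I: x(i)\ne 0\}\text{ is countable}\}$. Up-directed means nonempty and any two elements have an upper bound. An up-directed partially ordered set $\Gamma$ is $\sigma$-complete if every increasing sequence $(s_n)_{n\in\omega}$ ($s_n\le s_{n+1}$) has a supremum in $\Gamma$. A retractional skeleton on $K$ is a family $\mathfrak{s}=(r_s)_{s\in\Gamma}$ of continuous retractions on $K$ indexed by an up-directed $\sigma$-complete partially ordered set $\Gamma$ such that: (i) $r_s[K]$ is a metrizable compact space for each $s\in\Gamma$; (ii) if $s\le t$ then $r_s=r_t\circ r_s=r_s\circ r_t$; (iii) if $(s_n)_{n\in\omega}$ is increasing in $\Gamma$ and $s=\sup_n s_n$, then $r_s(x)=\lim_n r_{s_n}(x)$ for every $x\in K$; (iv) $x=\lim_{s\in\Gamma}r_s(x)$ for every $x\in K$. The set induced by $\mathfrak{s}$ is $D(\mathfrak{s})=\bigcup_{s\in\Gamma}r_s[K]$. $\mathfrak{s}$ is commutative if $r_s\circ r_t=r_t\circ r_s$ for all $s,t\in\Gamma$. A subskeleton of $\mathfrak{s}$ is a family $(r_s)_{s\in\Gamma'}$ where $\Gamma'\subset\Gamma$ is cofinal in $\Gamma$ (for every $s_0\in\Gamma$ there is $s\in\Gamma'$ with $s\ge s_0$) and $\sigma$-closed (closed under suprema, taken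 in $\Gamma$, of increasing sequences from $\Gamma'$). *)

theory Defs
  imports "HOL-Analysis.Analysis"
begin

text \<open>
  A poset is given by a carrier set \<open>\<Gamma>\<close> and a relation \<open>le\<close>, of which only the restriction
  to \<open>\<Gamma>\<close> matters.  Likewise a compact space is a compact subset \<open>K\<close> of a Hausdorff type, and
  self-maps of \<open>K\<close> are functions on the type of which only the restriction to \<open>K\<close> matters.
\<close>

definition partially_ordered :: "'i set \<Rightarrow> ('i \<Rightarrow> 'i \<Rightarrow> bool) \<Rightarrow> bool" where
  "partially_ordered \<Gamma> le \<longleftrightarrow> reflp_on \<Gamma> le \<and> transp_on \<Gamma> le \<and> antisymp_on \<Gamma> le"

definition up_directed :: "'i set \<Rightarrow> ('i \<Rightarrow> 'i \<Rightarrow> bool) \<Rightarrow> bool" where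
  "up_directed \<Gamma> le \<longleftrightarrow> \<Gamma> \<noteq> {} \<and> (\<forall>s\<in>\<Gamma>. \<forall>t\<in>\<Gamma>. \<exists>u\<in>\<Gamma>. le s u \<and> le t u)"

definition increasing_seq :: "'i set \<Rightarrow> ('i \<Rightarrow> 'i \<Rightarrow> bool) \<Rightarrow> (nat \<Rightarrow> 'i) \<Rightarrow> bool" where
  "increasing_seq \<Gamma> le s \<longleftrightarrow> (\<forall>n. s n \<in> \<Gamma> \<and> le (s n) (s (Suc n)))"

definition is_supremum :: "'i set \<Rightarrow> ('i \<Rightarrow> 'i \<Rightarrow> bool) \<Rightarrow> 'i set \<Rightarrow> 'i \<Rightarrow> bool" where
  "is_supremum \<Gamma> le S u \<longleftrightarrow>
     u \<in> \<Gamma> \<and> (\<forall>s\<in>S. le s u) \<and> (\<forall>v\<in>\<Gamma>. (\<forall>s\<in>S. le s v) \<longrightarrow> le u v)"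

definition sigma_complete :: "'i set \<Rightarrow> ('i \<Rightarrow> 'i \<Rightarrow> bool) \<Rightarrow> bool" where
  "sigma_complete \<Gamma> le \<longleftrightarrow>
     (\<forall>s. increasing_seq \<Gamma> le s \<longrightarrow> (\<exists>u. is_supremum \<Gamma> le (range s) u))"

text \<open>The filter of tails, along which nets indexed by \<open>\<Gamma>\<close> converge.\<close>

definition net_filter :: "'i set \<Rightarrow> ('i \<Rightarrow> 'i \<Rightarrow> bool) \<Rightarrow> 'i filter" where
  "net_filter \<Gamma> le = (INF s\<in>\<Gamma>. principal {t \<in> \<Gamma>. le s t})"

lemma eventually_net_filter:
  assumes "up_directed \<Gamma> le" "transp_on \<Gamma> le"
  shows "eventually P (net_filter \<Gamma> le) \<longleftrightarrow> (\<exists>s\<in>\<Gamma>. \<forall>t\<in>\<Gamma>. le s t \<longrightarrow> P t)"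
  unfolding net_filter_def
proof (subst eventually_INF_base)
  show "\<Gamma> \<noteq> {}"
    using assms(1) by (simp add: up_directed_def)
next
  fix s t assume st: "s \<in> \<Gamma>" "t \<in> \<Gamma>"
  with assms(1) obtain u where u: "u \<in> \<Gamma>" "le s u" "le t u"
    by (auto simp: up_directed_def)
  have "le s v" "le t v" if "v \<in> \<Gamma>" "le u v" for v
    using assms(2) st u that unfolding transp_on_def by blast+
  with u show "\<exists>x\<in>\<Gamma>. principal {v \<in> \<Gamma>. le x v} \<le>
      inf (principal {v \<in> \<Gamma>. le s v}) (principal {v \<in> \<Gamma>. le t v})"
    by (intro bexI[of _ u]) auto
qed (auto simp: eventually_principal)

definition retractional_skeleton ::
    "'a::t2_space set \<Rightarrow> 'i set \<Rightarrow> ('i \<Rightarrow> 'i \<Rightarrow> bool) \<Rightarrow> ('i \<Rightarrow> 'a \<Rightarrow> 'a) \<Rightarrow> bool" where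
  "retractional_skeleton K \<Gamma> le r \<longleftrightarrow>
     partially_ordered \<Gamma> le \<and> up_directed \<Gamma> le \<and> sigma_complete \<Gamma> le \<and>
     (\<forall>s\<in>\<Gamma>. retraction K (r s ` K) (r s)) \<and>
     (\<forall>s\<in>\<Gamma>. compact (r s ` K) \<and> metrizable_space (top_of_set (r s ` K))) \<and>
     (\<forall>s\<in>\<Gamma>. \<forall>t\<in>\<Gamma>. le s t \<longrightarrow> (\<forall>x\<in>K. r s x = r t (r s x) \<and> r s x = r s (r t x))) \<and>
     (\<forall>s u. increasing_seq \<Gamma> le s \<and> is_supremum \<Gamma> le (range s) u \<longrightarrow>
        (\<forall>x\<in>K. (\<lambda>n. r (s n) x) \<longlonglongrightarrow> r u x)) \<and>
     (\<forall>x\<in>K. ((\<lambda>s. r s x) \<longlongrightarrow> x) (net_filter \<Gamma> le))"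

definition induced_set :: "'a set \<Rightarrow> 'i set \<Rightarrow> ('i \<Rightarrow> 'a \<Rightarrow> 'a) \<Rightarrow> 'a set" where
  "induced_set K \<Gamma> r = (\<Union>s\<in>\<Gamma>. r s ` K)"

definition commuting_family :: "'a set \<Rightarrow> 'i set \<Rightarrow> ('i \<Rightarrow> 'a \<Rightarrow> 'a) \<Rightarrow> bool" where
  "commuting_family K \<Gamma> r \<longleftrightarrow> (\<forall>s\<in>\<Gamma>. \<forall>t\<in>\<Gamma>. \<forall>x\<in>K. r s (r t x) = r t (r s x))"

text \<open>
  The subskeleton of \<open>(r s)\<close> determined by \<open>\<Gamma>'\<close> is the restriction of the same family and
  order to \<open>\<Gamma>'\<close>, so only the index sets occur.  The suprema are those of \<open>\<Gamma>\<close>.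
\<close>

definition subskeleton_index :: "'i set \<Rightarrow> ('i \<Rightarrow> 'i \<Rightarrow> bool) \<Rightarrow> 'i set \<Rightarrow> bool" where
  "subskeleton_index \<Gamma> le \<Gamma>' \<longleftrightarrow>
     \<Gamma>' \<subseteq> \<Gamma> \<and> (\<forall>s\<^sub>0\<in>\<Gamma>. \<exists>s\<in>\<Gamma>'. le s\<^sub>0 s) \<and>
     (\<forall>s u. increasing_seq \<Gamma>' le s \<and> is_supremum \<Gamma> le (range s) u \<longrightarrow> u \<in> \<Gamma>')"

text \<open>
  Existence of a commutative skeleton inducing \<open>D\<close> whose index poset lives on the type \<open>'i\<close>;
  HOL cannot quantify existentially over that type, so it is a parameter.
\<close>

definition induced_by_commutative_skeleton ::
    "'i itself \<Rightarrow> 'a::t2_space set \<Rightarrow> 'a set \<Rightarrow> bool" where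
  "induced_by_commutative_skeleton I K D \<longleftrightarrow>
     (\<exists>(\<Delta> :: 'i set) le q. retractional_skeleton K \<Delta> le q \<and>
        commuting_family K \<Delta> q \<and> induced_set K \<Delta> q = D)"

definition has_commutative_subskeleton ::
    "'a set \<Rightarrow> 'i set \<Rightarrow> ('i \<Rightarrow> 'i \<Rightarrow> bool) \<Rightarrow> ('i \<Rightarrow> 'a \<Rightarrow> 'a) \<Rightarrow> bool" where
  "has_commutative_subskeleton K \<Gamma> le r \<longleftrightarrow>
     (\<exists>\<Gamma>'. subskeleton_index \<Gamma> le \<Gamma>' \<and> commuting_family K \<Gamma>' r)"

definition has_subskeleton_with_limit_closed_dense_set ::
    "'a::t2_space set \<Rightarrow> 'i set \<Rightarrow> ('i \<Rightarrow> 'i \<Rightarrow> bool) \<Rightarrow> ('i \<Rightarrow> 'a \<Rightarrow> 'a) \<Rightarrow> bool" where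
  "has_subskeleton_with_limit_closed_dense_set K \<Gamma> le r \<longleftrightarrow>
     (\<exists>\<Gamma>' D. subskeleton_index \<Gamma> le \<Gamma>' \<and> D \<subseteq> induced_set K \<Gamma> r \<and> K \<subseteq> closure D \<and>
        (\<forall>\<Gamma>''. \<Gamma>'' \<subseteq> \<Gamma>' \<and> up_directed \<Gamma>'' le \<longrightarrow>
           (\<forall>x\<in>D. \<exists>y\<in>D. ((\<lambda>s. r s x) \<longlongrightarrow> y) (net_filter \<Gamma>'' le))))"

text \<open>
  The metric space \<open>C(K)\<close>; its elements are real functions that are \<open>undefined\<close> outside \<open>K\<close>,
  hence the restricted abstractions below.
\<close>

abbreviation C_space :: "'a::t2_space set \<Rightarrow> ('a \<Rightarrow> real) metric" where
  "C_space K \<equiv> cfunspace (top_of_set K) euclidean_metric"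

definition symmetric_fun_set :: "'a set \<Rightarrow> ('a \<Rightarrow> real) set \<Rightarrow> bool" where
  "symmetric_fun_set K A \<longleftrightarrow> (\<forall>f\<in>A. (\<lambda>x\<in>K. - f x) \<in> A)"

definition convex_fun_set :: "'a set \<Rightarrow> ('a \<Rightarrow> real) set \<Rightarrow> bool" where
  "convex_fun_set K A \<longleftrightarrow>
     (\<forall>f\<in>A. \<forall>g\<in>A. \<forall>t\<in>{0..1}. (\<lambda>x\<in>K. (1 - t) * f x + t * g x) \<in> A)"

definition separates_points :: "'a set \<Rightarrow> ('a \<Rightarrow> real) set \<Rightarrow> bool" where
  "separates_points K A \<longleftrightarrow> (\<forall>x\<in>K. \<forall>y\<in>K. x \<noteq> y \<longrightarrow> (\<exists>f\<in>A. f x \<noteq> f y))"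

text \<open>\<open>\<real>\<^sup>I\<close> consists of the functions that are \<open>undefined\<close> outside \<open>I\<close>, as in the library's
  product topology.\<close>

definition Sigma_space :: "'j set \<Rightarrow> ('j \<Rightarrow> real) set" where
  "Sigma_space I = {x \<in> I \<rightarrow>\<^sub>E UNIV. countable {i \<in> I. x i \<noteq> 0}}"

definition evaluation_map :: "real \<Rightarrow> ('a \<Rightarrow> real) set \<Rightarrow> 'a \<Rightarrow> ('a \<Rightarrow> real) \<Rightarrow> real" where
  "evaluation_map c H x = (\<lambda>h\<in>H. 1 / c * h x)"

definition has_Sigma_embedding ::
    "'a::t2_space set \<Rightarrow> 'a set \<Rightarrow> real \<Rightarrow> ('a \<Rightarrow> real) set \<Rightarrow> bool" where
  "has_Sigma_embedding K D c A \<longleftrightarrow>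
     (\<exists>H\<subseteq>A. embedding_map (top_of_set K) (product_topology (\<lambda>_. top_of_set {-1..1}) H)
                (evaluation_map c H) \<and>
             evaluation_map c H ` D \<subseteq> Sigma_space H)"

end

theory Submission
  imports Defs
begin

text \<open>
  By Stone--Weierstrass and \<open>\<sigma>\<close>-completeness, every \<open>f \<in> C(K)\<close> satisfies
  \<open>f = f \<circ> r\<^sub>s\<close> for some \<open>s\<close>, and \<open>f \<circ> r\<^sub>s\<close> converges uniformly along every up-directed set of
  indices \<open>\<Lambda>\<close>, so the limit projection \<open>R\<^sub>\<Lambda>\<close> exists.

  (i) implies (ii): interleaving increasing sequences from the two skeletons shows that they share
  cofinally many retractions.  (ii) implies (iii): take \<open>D\<close> to be the induced set.  (iv) implies (ii):
  the \<open>r\<^sub>s\<close> for which every \<open>h \<circ> r\<^sub>s\<close> is \<open>h\<close> or \<open>0\<close> commute and form a subskeleton.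

  (iii) implies (iv): by induction on the cardinality of \<open>\<Lambda>\<close>, the range of \<open>R\<^sub>\<Lambda>\<close> has a separating
  family \<open>H \<subseteq> A\<close> that is point-countable on \<open>D\<close>.  An uncountable \<open>\<Lambda>\<close> is an increasing union of
  directed sets \<open>\<Lambda>\<^sub>a\<close> of smaller size, and \<open>H\<close> consists of the functions
  \<open>(h - h \<circ> R\<^sub>\<Lambda>\<^sub>a) / 2\<close> with \<open>h\<close> in the family of the next stage.  For \<open>x \<in> D\<close> only countably many
  stages contribute, because all \<open>R\<^sub>\<Lambda>\<^sub>a x\<close> lie in \<open>D\<close> and the induced set has countable tightness.
  Finally (iii) implies (ii) by applying this to the unit ball of \<open>C(K)\<close>.
\<close>

section \<open>Second countable and compact Hausdorff spaces\<close>

text \<open>Total boundedness gives a finite net at each scale \<open>1 / (n + 1)\<close>; the balls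
  of that radius around the net points form a countable base.\<close>

lemma compact_metrizable_imp_second_countable:
  assumes "compact_space X" "metrizable_space X"
  shows "second_countable X"
proof -
  obtain M d where "Metric_space M d" and X: "X = Metric_space.mtopology M d"
    using assms(2) by (auto simp: metrizable_space_def)
  then interpret Metric_space M d by simp
  have "mtotally_bounded M"
    using assms(1) by (intro compactin_imp_mtotally_bounded) (simp add: X compact_space_def)
  then have "\<exists>C. finite C \<and> C \<subseteq> M \<and> M \<subseteq> (\<Union>x\<in>C. mball x (inverse (Suc n)))" for n
    unfolding mtotally_bounded_def by (meson inverse_Suc)
  then obtain C where C: "\<And>n::nat. finite (C n)" "\<And>n. C n \<subseteq> M"
      "\<And>n. M \<subseteq> (\<Union>x\<in>C n. mball x (inverse (Suc n)))"
    by metis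
  define \<B> where "\<B> = (\<Union>n::nat. (\<lambda>x. mball x (inverse (Suc n))) ` C n)"
  show ?thesis
    unfolding second_countable_def
  proof (intro exI conjI allI impI)
    show "countable \<B>"
      unfolding \<B>_def by (intro countable_UN) (auto simp: C countable_finite)
    show "\<forall>V\<in>\<B>. openin X V"
      by (auto simp: \<B>_def X)
    fix U x assume U: "openin X U \<and> x \<in> U"
    then obtain e where e: "e > 0" "mball x e \<subseteq> U"
      by (auto simp: X openin_mtopology)
    \<comment> \<open>With radius below \<open>e / 2\<close>, any such ball that contains
      \<open>x\<close> stays inside \<open>mball x e\<close>.\<close>
    obtain n where n: "inverse (real (Suc n)) < e / 2"
      using e(1) reals_Archimedean half_gt_zero by blast
    have "x \<in> M"
      using U openin_subset X by fastforce
    then obtain c where c: "c \<in> C n" "x \<in> mball c (inverse (Suc n))"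
      using C(3) by blast
    have "mball c (inverse (Suc n)) \<subseteq> mball x e"
      using c(2) n by (intro mball_subset) (auto simp: commute)
    with c e(2) show "\<exists>V\<in>\<B>. x \<in> V \<and> V \<subseteq> U"
      unfolding \<B>_def by (intro bexI[of _ "mball c (inverse (Suc n))"]) auto
  qed
qed

lemma second_countable_base:
  assumes "second_countable (top_of_set M)"
  obtains \<B> where "countable \<B>" "\<And>V. V \<in> \<B> \<Longrightarrow> V \<subseteq> M"
    "\<And>x U. x \<in> M \<Longrightarrow> x \<in> U \<Longrightarrow> open U \<Longrightarrow> \<exists>V\<in>\<B>. x \<in> V \<and> V \<subseteq> U"
proof -
  obtain \<B> where \<B>: "countable \<B>" "\<And>V. V \<in> \<B> \<Longrightarrow> openin (top_of_set M) V"
    "\<And>U x. openin (top_of_set M) U \<and> x \<in> U \<Longrightarrow> \<exists>V\<in>\<B>. x \<in> V \<and> V \<subseteq> U"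
    using assms unfolding second_countable_def by auto
  show ?thesis
  proof (rule that[OF \<B>(1)])
    show "V \<subseteq> M" if "V \<in> \<B>" for V
      using openin_subset[OF \<B>(2)[OF that]] by simp
    show "\<exists>V\<in>\<B>. x \<in> V \<and> V \<subseteq> U" if "x \<in> M" "x \<in> U" "open U" for x U
      using \<B>(3)[of "M \<inter> U" x] that openin_open_Int by blast
  qed
qed

text \<open>The subspace \<open>B\<close> inherits a countable base, and one point chosen from each
  nonempty member of it gives a dense set inside \<open>B\<close> itself.\<close>

lemma second_countable_dense_subset:
  assumes "second_countable (top_of_set M)" "B \<subseteq> M"
  obtains C where "countable C" "C \<subseteq> B" "B \<subseteq> closure C"
proof -
  have "second_countable (top_of_set B)"
    using second_countable_subtopology[OF assms(1), of B] assms(2)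
    by (simp add: subtopology_subtopology inf.absorb2)
  then obtain \<B> where \<B>: "countable \<B>" "\<And>V. V \<in> \<B> \<Longrightarrow> V \<subseteq> B"
    "\<And>x U. x \<in> B \<Longrightarrow> x \<in> U \<Longrightarrow> open U \<Longrightarrow> \<exists>V\<in>\<B>. x \<in> V \<and> V \<subseteq> U"
    by (rule second_countable_base) blast
  define p where "p V = (SOME x. x \<in> V)" for V :: "'a set"
  have p: "p V \<in> V" if "x \<in> V" for V x
    using that unfolding p_def by (rule someI)
  show ?thesis
  proof
    show "countable (p ` (\<B> - {{}}))"
      using \<B>(1) by simp
    show "p ` (\<B> - {{}}) \<subseteq> B"
      using \<B>(2) p by blast
    show "B \<subseteq> closure (p ` (\<B> - {{}}))"
    proof
      fix x assume x: "x \<in> B"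
      have "\<exists>y\<in>p ` (\<B> - {{}}). y \<in> U" if U: "x \<in> U" "open U" for U
      proof -
        obtain V where "V \<in> \<B>" "x \<in> V" "V \<subseteq> U"
          using \<B>(3)[OF x U] by blast
        with p[of x V] show ?thesis
          by (intro bexI[of _ "p V"]) auto
      qed
      then show "x \<in> closure (p ` (\<B> - {{}}))"
        unfolding closure_iff_nhds_not_empty by (metis disjoint_iff subsetD)
    qed
  qed
qed

text \<open>By continuity and the Hausdorff property of the range, two distinct points have base
  neighbourhoods that a single function separates as a whole. One function is chosen for each of the
  countably many pairs of base sets.\<close>

lemma countable_separating_subset:
  fixes A :: "('a::t2_space \<Rightarrow> 'b::t2_space) set"
  assumes "second_countable (top_of_set M)"
    and cont: "\<And>f. f \<in> A \<Longrightarrow> continuous_on M f"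
    and sep: "\<And>x y. x \<in> M \<Longrightarrow> y \<in> M \<Longrightarrow> x \<noteq> y \<Longrightarrow> \<exists>f\<in>A. f x \<noteq> f y"
  obtains F where "countable F" "F \<subseteq> A"
    "\<And>x y. x \<in> M \<Longrightarrow> y \<in> M \<Longrightarrow> x \<noteq> y \<Longrightarrow> \<exists>f\<in>F. f x \<noteq> f y"
proof -
  obtain \<B> where \<B>: "countable \<B>" "\<And>V. V \<in> \<B> \<Longrightarrow> V \<subseteq> M"
    "\<And>x U. x \<in> M \<Longrightarrow> x \<in> U \<Longrightarrow> open U \<Longrightarrow> \<exists>V\<in>\<B>. x \<in> V \<and> V \<subseteq> U"
    using assms(1) by (rule second_countable_base) blast
  \<comment> \<open>\<open>f\<close> must separate every point of \<open>U\<close> from every point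
    of \<open>V\<close>, so that whichever function is chosen for the pair does the job.\<close>
  define good where "good = (\<lambda>(U, V) f. f \<in> A \<and> (\<forall>x\<in>U. \<forall>y\<in>V. f x \<noteq> f y))"
  define F where "F = (\<lambda>p. SOME f. good p f) ` {p \<in> \<B> \<times> \<B>. \<exists>f. good p f}"
  have F: "good p (SOME f. good p f)" if "\<exists>f. good p f" for p
    using that by (rule someI_ex)
  show ?thesis
  proof
    show "countable F"
      unfolding F_def using \<B>(1) by (intro countable_image countable_Collect) auto
    show "F \<subseteq> A"
      using F by (fastforce simp: F_def good_def)
    fix x y assume xy: "x \<in> M" "y \<in> M" "x \<noteq> y"
    then obtain f where f: "f \<in> A" "f x \<noteq> f y"
      using sep by blast
    then obtain S T where ST: "open S" "open T" "f x \<in> S" "f y \<in> T" "S \<inter> T = {}"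
      using hausdorff[OF f(2)] by blast
    note inv = cont[OF f(1), unfolded continuous_on_open_invariant, rule_format]
    obtain S' where S': "open S'" "S' \<inter> M = f -` S \<inter> M"
      using inv[OF ST(1)] by blast
    obtain T' where T': "open T'" "T' \<inter> M = f -` T \<inter> M"
      using inv[OF ST(2)] by blast
    obtain U where U: "U \<in> \<B>" "x \<in> U" "U \<subseteq> S'"
      using \<B>(3)[of x S'] xy S' ST by blast
    obtain V where V: "V \<in> \<B>" "y \<in> V" "V \<subseteq> T'"
      using \<B>(3)[of y T'] xy T' ST by blast
    have "U \<subseteq> M" "V \<subseteq> M"
      using U V \<B>(2) by auto
    then have "U \<subseteq> f -` S \<inter> M" "V \<subseteq> f -` T \<inter> M"
      using U(3) V(3) unfolding S'(2)[symmetric] T'(2)[symmetric] by auto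
    then have "f ` U \<subseteq> S" "f ` V \<subseteq> T"
      by auto
    then have "good (U, V) f"
      using f(1) ST(5) unfolding good_def by (simp, metis disjoint_iff image_subset_iff)
    then have "(SOME f. good (U, V) f) \<in> F" "good (U, V) (SOME f. good (U, V) f)"
      using F[of "(U, V)"] U(1) V(1) unfolding F_def by blast+
    with U(2) V(2) show "\<exists>f\<in>F. f x \<noteq> f y"
      unfolding good_def by blast
  qed
qed

text \<open>Compact Hausdorff spaces are completely regular; this is applied to the point
  \<open>x\<close> and the relatively closed set \<open>K - U\<close>.\<close>

lemma compact_Urysohn:
  fixes K :: "'a::t2_space set"
  assumes "compact K" "x \<in> K" "x \<in> U" "open U"
  obtains f :: "'a \<Rightarrow> real" where "continuous_on K f" "f ` K \<subseteq> {0..1}" "f x = 1"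
    "\<And>y. y \<in> K \<Longrightarrow> y \<notin> U \<Longrightarrow> f y = 0"
proof -
  have "Hausdorff_space (euclidean :: 'a topology)"
    unfolding Hausdorff_space_def disjnt_def using hausdorff by (metis open_openin)
  then have "completely_regular_space (top_of_set K)"
    using assms(1) by (intro locally_compact_regular_imp_completely_regular_space
        compact_imp_locally_compact_space disjI1)
      (simp_all add: Hausdorff_space_subtopology compact_space_subtopology)
  moreover have "closedin (top_of_set K) (K - U)"
    using assms(4) closedin_closed_Int[of "- U" K] by (simp add: Diff_eq closed_def)
  moreover have "x \<in> topspace (top_of_set K) - (K - U)"
    using assms by simp
  ultimately obtain f where f: "continuous_map (top_of_set K) (top_of_set {0..1::real}) f"
      "f x = 0" "f ` (K - U) \<subseteq> {1}"
    unfolding completely_regular_space_def by metis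
  show ?thesis
  proof
    \<comment> \<open>Complete regularity yields the value 0 at \<open>x\<close> and 1 off
      \<open>U\<close>, so the values are swapped.\<close>
    show "continuous_on K (\<lambda>x. 1 - f x)"
      using f(1) by (intro continuous_intros) (auto simp: continuous_map_in_subtopology)
    show "(\<lambda>x. 1 - f x) ` K \<subseteq> {0..1}"
      using f(1) by (fastforce simp: continuous_map_in_subtopology)
  qed (use f in auto)
qed

lemma compact_Urysohn_separate:
  fixes K :: "'a::t2_space set"
  assumes "compact K" "x \<in> K" "y \<in> K" "x \<noteq> y"
  obtains f :: "'a \<Rightarrow> real" where "continuous_on K f" "f ` K \<subseteq> {0..1}" "f x \<noteq> f y"
proof -
  obtain f :: "'a \<Rightarrow> real" where "continuous_on K f" "f ` K \<subseteq> {0..1}" "f x = 1"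
    "\<And>z. z \<in> K \<Longrightarrow> z \<notin> - {y} \<Longrightarrow> f z = 0"
    using compact_Urysohn[of K x "- {y}"] assms by auto
  with assms(3) that[of f] show ?thesis by simp
qed

text \<open>The zero set of \<open>f - g\<close> in \<open>K\<close> is closed in the whole type
  because \<open>K\<close> is.\<close>

lemma eq_on_closure:
  fixes f g :: "'a::topological_space \<Rightarrow> real"
  assumes "closed K" "continuous_on K f" "continuous_on K g" "C \<subseteq> K"
    and "\<And>x. x \<in> C \<Longrightarrow> f x = g x" "y \<in> closure C"
  shows "f y = g y"
proof -
  have "closed (K \<inter> (\<lambda>x. f x - g x) -` {0})"
    using assms(1-3) by (intro continuous_closed_preimage continuous_intros) auto
  with assms(4,5) have "closure C \<subseteq> K \<inter> (\<lambda>x. f x - g x) -` {0}"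
    by (intro closure_minimal) auto
  with assms(6) show ?thesis by auto
qed

section \<open>Retractional skeletons\<close>

lemma increasing_seq_mono:
  assumes "increasing_seq \<Gamma> le s" "reflp_on \<Gamma> le" "transp_on \<Gamma> le" "m \<le> n"
  shows "le (s m) (s n)"
  using assms(4)
proof (induction rule: dec_induct)
  case base
  then show ?case using assms by (auto simp: increasing_seq_def reflp_on_def)
next
  case (step k)
  then show ?case using assms(1,3) unfolding increasing_seq_def transp_on_def by blast
qed

lemma net_filter_neq_bot:
  assumes "up_directed \<Lambda> le" "transp_on \<Lambda> le"
  shows "net_filter \<Lambda> le \<noteq> bot"
  unfolding trivial_limit_def eventually_net_filter[OF assms]
  using assms(1) unfolding up_directed_def by blast

text \<open>The index set, order and maps are parameters, so that all facts can also be instantiated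
  for a second skeleton on the same \<open>K\<close> with another index type.\<close>

locale compact_skeleton =
  fixes K :: "'a::t2_space set" and \<Gamma> :: "'i set" and le :: "'i \<Rightarrow> 'i \<Rightarrow> bool"
    and r :: "'i \<Rightarrow> 'a \<Rightarrow> 'a"
  assumes compact_K: "compact K" and skeleton: "retractional_skeleton K \<Gamma> le r"
begin

section \<open>Elementary consequences of the skeleton axioms\<close>

lemma le_refl: "s \<in> \<Gamma> \<Longrightarrow> le s s"
  using skeleton by (auto simp: retractional_skeleton_def partially_ordered_def reflp_on_def)

lemma le_trans: "le s t \<Longrightarrow> le t u \<Longrightarrow> s \<in> \<Gamma> \<Longrightarrow> t \<in> \<Gamma> \<Longrightarrow> u \<in> \<Gamma> \<Longrightarrow> le s u"
  using skeleton unfolding retractional_skeleton_def partially_ordered_def transp_on_def by blast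

lemma le_antisym: "le s t \<Longrightarrow> le t s \<Longrightarrow> s \<in> \<Gamma> \<Longrightarrow> t \<in> \<Gamma> \<Longrightarrow> s = t"
  using skeleton unfolding retractional_skeleton_def partially_ordered_def antisymp_on_def by blast

lemma transp_on: "\<Lambda> \<subseteq> \<Gamma> \<Longrightarrow> transp_on \<Lambda> le"
  using skeleton unfolding retractional_skeleton_def partially_ordered_def
  by (meson transp_on_subset)

lemma directed: "up_directed \<Gamma> le"
  using skeleton by (simp add: retractional_skeleton_def)

lemma upper_bound: "s \<in> \<Gamma> \<Longrightarrow> t \<in> \<Gamma> \<Longrightarrow> \<exists>u\<in>\<Gamma>. le s u \<and> le t u"
  using directed by (simp add: up_directed_def)

lemma sup_exists: "increasing_seq \<Gamma> le s \<Longrightarrow> \<exists>u. is_supremum \<Gamma> le (range s) u"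
  using skeleton by (auto simp: retractional_skeleton_def sigma_complete_def)

lemma is_supremumD:
  assumes "is_supremum \<Gamma> le (range s) u"
  shows "u \<in> \<Gamma>" "le (s n) u"
  using assms by (auto simp: is_supremum_def)

lemma seq_mono: "increasing_seq \<Gamma> le s \<Longrightarrow> m \<le> n \<Longrightarrow> le (s m) (s n)"
  using skeleton increasing_seq_mono
  unfolding retractional_skeleton_def partially_ordered_def by blast

lemma retraction: "s \<in> \<Gamma> \<Longrightarrow> retraction K (r s ` K) (r s)"
  using skeleton by (simp add: retractional_skeleton_def)

lemma r_in_K: "s \<in> \<Gamma> \<Longrightarrow> x \<in> K \<Longrightarrow> r s x \<in> K"
  using retraction unfolding retraction_def by blast

lemma r_continuous: "s \<in> \<Gamma> \<Longrightarrow> continuous_on K (r s)"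
  using retraction by (simp add: retraction_def)

lemma r_idem: "s \<in> \<Gamma> \<Longrightarrow> x \<in> K \<Longrightarrow> r s (r s x) = r s x"
  using retraction by (simp add: retraction_def)

lemma r_image_iff: "s \<in> \<Gamma> \<Longrightarrow> x \<in> r s ` K \<longleftrightarrow> x \<in> K \<and> r s x = x"
  by (auto simp: r_idem r_in_K intro: rev_image_eqI)

lemma r_image_subset: "s \<in> \<Gamma> \<Longrightarrow> r s ` K \<subseteq> K"
  using r_in_K by blast

lemma r_absorb:
  assumes "s \<in> \<Gamma>" "t \<in> \<Gamma>" "le s t" "x \<in> K"
  shows "r t (r s x) = r s x" "r s (r t x) = r s x"
  using skeleton assms unfolding retractional_skeleton_def by metis+

lemma r_image_mono: "s \<in> \<Gamma> \<Longrightarrow> t \<in> \<Gamma> \<Longrightarrow> le s t \<Longrightarrow> r s ` K \<subseteq> r t ` K"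
  using r_absorb(1) r_in_K by (metis image_subsetI rev_image_eqI)

lemma r_image_compact: "s \<in> \<Gamma> \<Longrightarrow> compact (r s ` K)"
  using skeleton by (simp add: retractional_skeleton_def)

lemma r_image_closed: "s \<in> \<Gamma> \<Longrightarrow> closed (r s ` K)"
  using r_image_compact compact_imp_closed by blast

lemma r_image_second_countable: "s \<in> \<Gamma> \<Longrightarrow> second_countable (top_of_set (r s ` K))"
  using skeleton
  by (intro compact_metrizable_imp_second_countable)
     (auto simp: retractional_skeleton_def compact_space_subtopology)

lemma r_seq_limit:
  assumes "increasing_seq \<Gamma> le s" "is_supremum \<Gamma> le (range s) u" "x \<in> K"
  shows "(\<lambda>n. r (s n) x) \<longlonglongrightarrow> r u x"
  using skeleton assms by (simp add: retractional_skeleton_def)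

lemma r_net_limit: "x \<in> K \<Longrightarrow> ((\<lambda>s. r s x) \<longlongrightarrow> x) (net_filter \<Gamma> le)"
  using skeleton by (simp add: retractional_skeleton_def)

lemma comp_r_continuous:
  "continuous_on K f \<Longrightarrow> s \<in> \<Gamma> \<Longrightarrow> continuous_on K (\<lambda>x. f (r s x))"
  by (rule continuous_on_compose2[OF _ r_continuous r_image_subset])

text \<open>Factoring through \<open>r s\<close> persists upwards:
  \<open>f (r t x) = f (r s (r t x)) = f (r s x) = f x\<close>.\<close>

lemma comp_r_mono:
  assumes "s \<in> \<Gamma>" "t \<in> \<Gamma>" "le s t" "\<forall>x\<in>K. f (r s x) = f x"
  shows "\<forall>x\<in>K. f (r t x) = f x"
  using assms r_absorb r_in_K by metis

text \<open>Otherwise the nets of images of \<open>x\<close> and \<open>y\<close> coincide and,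
  limits being unique, so do \<open>x\<close> and \<open>y\<close>.\<close>

lemma separated_by_r:
  assumes "x \<in> K" "y \<in> K" "x \<noteq> y"
  shows "\<exists>s\<in>\<Gamma>. r s x \<noteq> r s y"
proof (rule ccontr)
  assume "\<not> ?thesis"
  then have "\<forall>\<^sub>F s in net_filter \<Gamma> le. r s x = r s y"
    unfolding eventually_net_filter[OF directed transp_on[OF order_refl]]
    using directed by (auto simp: up_directed_def)
  then have "((\<lambda>s. r s x) \<longlongrightarrow> y) (net_filter \<Gamma> le)"
    using r_net_limit[OF assms(2)] by (simp cong: filterlim_cong)
  with r_net_limit[OF assms(1)] assms(3)
  show False
    using tendsto_unique net_filter_neq_bot[OF directed transp_on[OF order_refl]] by blast
qed

text \<open>The form in which dependent choice and \<sigma>-completeness enter the closing-off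
  arguments: \<open>Q\<close> records what each step has to absorb, and the supremum
  \<open>u\<close> collects all steps.\<close>

lemma increasing_sequence_from:
  assumes "s\<^sub>0 \<in> \<Gamma>" and "\<And>s. s \<in> \<Gamma> \<Longrightarrow> \<exists>t\<in>\<Gamma>. le s t \<and> Q s t"
  obtains s u where "s 0 = s\<^sub>0" "increasing_seq \<Gamma> le s" "is_supremum \<Gamma> le (range s) u"
    "\<And>n. Q (s n) (s (Suc n))"
proof -
  have "\<exists>s. s 0 = s\<^sub>0 \<and> (\<forall>n. s n \<in> \<Gamma> \<and> le (s n) (s (Suc n)) \<and> Q (s n) (s (Suc n)))"
    \<comment> \<open>The clause for \<open>n = 0\<close> pins the first term to
      \<open>s\<^sub>0\<close>.\<close>
    using dependent_nat_choice[of "\<lambda>n x. x \<in> \<Gamma> \<and> (n = 0 \<longrightarrow> x = s\<^sub>0)" "\<lambda>n x y. le x y \<and> Q x y"]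
      assms by (metis nat.distinct(1))
  then obtain s where s: "s 0 = s\<^sub>0" "\<forall>n. s n \<in> \<Gamma> \<and> le (s n) (s (Suc n)) \<and> Q (s n) (s (Suc n))"
    by blast
  then have "increasing_seq \<Gamma> le s"
    by (simp add: increasing_seq_def)
  with s that sup_exists show ?thesis by metis
qed

text \<open>Along an enumeration of \<open>S\<close> an increasing sequence dominates one more
  element at each step, and its supremum dominates all of them. Thus directedness improves to
  countable directedness.\<close>

lemma countable_upper_bound:
  assumes "countable S" "S \<subseteq> \<Gamma>" "s\<^sub>0 \<in> \<Gamma>"
  obtains u where "u \<in> \<Gamma>" "le s\<^sub>0 u" "\<And>s. s \<in> S \<Longrightarrow> le s u"
proof (cases "S = {}")
  case True
  then show ?thesis using that le_refl assms(3) by blast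
next
  case False
  define e where "e = from_nat_into S"
  have e: "range e = S"
    unfolding e_def using False assms(1) by (rule range_from_nat_into)
  have "\<exists>s. s 0 = s\<^sub>0 \<and> (\<forall>n. s n \<in> \<Gamma> \<and> le (s n) (s (Suc n)) \<and> le (e n) (s (Suc n)))"
    using dependent_nat_choice[of "\<lambda>n x. x \<in> \<Gamma> \<and> (n = 0 \<longrightarrow> x = s\<^sub>0)" "\<lambda>n x y. le x y \<and> le (e n) y"]
      assms upper_bound e by (metis nat.distinct(1) rangeI subsetD)
  then obtain s where s: "s 0 = s\<^sub>0" "\<And>n. s n \<in> \<Gamma>" "\<And>n. le (s n) (s (Suc n))" "\<And>n. le (e n) (s (Suc n))"
    by blast
  then have "increasing_seq \<Gamma> le s"
    by (simp add: increasing_seq_def)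
  then obtain u where u: "is_supremum \<Gamma> le (range s) u"
    using sup_exists by blast
  show ?thesis
  proof
    show "u \<in> \<Gamma>" "le s\<^sub>0 u"
      using is_supremumD[OF u] s(1) by metis+
    show "le t u" if t: "t \<in> S" for t
    proof -
      obtain n where "t = e n" using t e by blast
      with s(2,4) t assms(2) show ?thesis
        by (intro le_trans[of t "s (Suc n)" u] is_supremumD[OF u]) auto
    qed
  qed
qed

text \<open>Stone--Weierstrass on \<open>M\<close>: the functions \<open>g\<close> with
  \<open>g \<circ> r s = g\<close> for some \<open>s \<in> \<Lambda>\<close> form a separating
  algebra. If such a \<open>g\<close> is within \<open>e / 2\<close> of \<open>f\<close>, then
  \<open>f \<circ> r t\<close> is within \<open>e\<close> of \<open>f\<close> for all
  \<open>t\<close> beyond \<open>s\<close>, as \<open>M\<close> is invariant.\<close>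

lemma comp_r_uniform_limit:
  assumes M: "compact M" "M \<subseteq> K" and \<Lambda>: "\<Lambda> \<subseteq> \<Gamma>" "up_directed \<Lambda> le"
    and inv: "\<And>s x. s \<in> \<Lambda> \<Longrightarrow> x \<in> M \<Longrightarrow> r s x \<in> M"
    and sep: "\<And>x y. x \<in> M \<Longrightarrow> y \<in> M \<Longrightarrow> x \<noteq> y \<Longrightarrow> \<exists>s\<in>\<Lambda>. r s x \<noteq> r s y"
    and f: "continuous_on M f" and e: "e > (0::real)"
  shows "\<exists>s\<in>\<Lambda>. \<forall>t\<in>\<Lambda>. le s t \<longrightarrow> (\<forall>x\<in>M. \<bar>f (r t x) - f x\<bar> < e)"
proof -
  let ?P = "\<lambda>g :: 'a \<Rightarrow> real. continuous_on M g \<and> (\<exists>s\<in>\<Lambda>. \<forall>x\<in>M. g (r s x) = g x)"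
  have up: "\<forall>x\<in>M. g (r t x) = g x"
    if "s \<in> \<Lambda>" "t \<in> \<Lambda>" "le s t" "\<forall>x\<in>M. g (r s x) = g x" for s t and g :: "'a \<Rightarrow> real"
    using that inv r_absorb M(2) \<Lambda>(1) by (metis subsetD)
  \<comment> \<open>Sums and products are treated at once: a common upper bound of the two indices
    serves both functions.\<close>
  have alg: "?P (\<lambda>x. h (g1 x) (g2 x))"
    if g: "?P g1" "?P g2" and h: "continuous_on M (\<lambda>x. h (g1 x) (g2 x))" for g1 g2 h
  proof -
    obtain s t where st: "s \<in> \<Lambda>" "t \<in> \<Lambda>" "\<forall>x\<in>M. g1 (r s x) = g1 x" "\<forall>x\<in>M. g2 (r t x) = g2 x"
      using g by blast
    obtain u where u: "u \<in> \<Lambda>" "le s u" "le t u"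
      using \<Lambda>(2) st(1,2) by (auto simp: up_directed_def)
    have "\<forall>x\<in>M. g1 (r u x) = g1 x" "\<forall>x\<in>M. g2 (r u x) = g2 x"
      using up st u by blast+
    with u(1) have "\<exists>s\<in>\<Lambda>. \<forall>x\<in>M. h (g1 (r s x)) (g2 (r s x)) = h (g1 x) (g2 x)"
      by (intro bexI[of _ u]) simp_all
    with h show ?thesis by blast
  qed
  have "\<exists>g. ?P g \<and> (\<forall>x\<in>M. \<bar>f x - g x\<bar> < e / 2)"
  proof (rule Stone_Weierstrass_HOL)
    show "?P (\<lambda>x. c)" for c
      using \<Lambda>(2) by (auto simp: up_directed_def)
    show "?P (\<lambda>x. g x + h x)" if "?P g \<and> ?P h" for g h
      using that by (intro alg[of g h "(+)"] continuous_intros) blast+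
    show "?P (\<lambda>x. g x * h x)" if "?P g \<and> ?P h" for g h
      using that by (intro alg[of g h "(*)"] continuous_intros) blast+
    show "\<exists>g. ?P g \<and> g x \<noteq> g y" if xy: "x \<in> M \<and> y \<in> M \<and> x \<noteq> y" for x y
    proof -
      \<comment> \<open>A Urysohn function separating \<open>r s x\<close> from
        \<open>r s y\<close>, composed with \<open>r s\<close>, lies in the algebra because
        \<open>r s\<close> is idempotent.\<close>
      obtain s where s: "s \<in> \<Lambda>" "r s x \<noteq> r s y"
        using sep xy by blast
      have rK: "r s x \<in> K" "r s y \<in> K"
        using r_in_K s(1) xy M(2) \<Lambda>(1) by auto
      obtain g :: "'a \<Rightarrow> real" where g: "continuous_on K g" "g (r s x) \<noteq> g (r s y)"
        by (rule compact_Urysohn_separate[OF compact_K rK s(2)])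
      have "continuous_on M (\<lambda>x. g (r s x))"
        using comp_r_continuous[OF g(1), of s] s(1) \<Lambda>(1) continuous_on_subset[OF _ M(2)] by blast
      then show ?thesis
        using s g(2) r_idem \<Lambda>(1) M(2)
        by (intro exI[of _ "\<lambda>x. g (r s x)"] conjI bexI[of _ s] ballI) (auto simp: subset_iff)
    qed
  qed (use M f e in auto)
  then obtain g s where g: "continuous_on M g" "s \<in> \<Lambda>" "\<forall>x\<in>M. g (r s x) = g x"
      "\<forall>x\<in>M. \<bar>f x - g x\<bar> < e / 2" by blast
  have "\<bar>f (r t x) - f x\<bar> < e" if t: "t \<in> \<Lambda>" "le s t" "x \<in> M" for t x
  proof -
    have "g (r t x) = g x"
      using up[OF g(2) t(1,2) g(3)] t(3) by blast
    with g(4) inv[OF t(1,3)] t(3) show ?thesis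
      by (smt (verit) field_sum_of_halves)
  qed
  with g(2) show ?thesis by blast
qed

text \<open>Hence \<open>C(K)\<close> is the union, not only the closure of the union, of the subalgebras of functions
  factoring through a retraction: countably many approximants are absorbed by a supremum.\<close>

lemma factors_through_r:
  fixes f :: "'a \<Rightarrow> real"
  assumes f: "continuous_on K f"
  shows "\<exists>s\<in>\<Gamma>. \<forall>x\<in>K. f (r s x) = f x"
proof -
  have "\<exists>s\<in>\<Gamma>. \<forall>t\<in>\<Gamma>. le s t \<longrightarrow> (\<forall>x\<in>K. \<bar>f (r t x) - f x\<bar> < inverse (real (Suc n)))" for n
    using r_in_K separated_by_r
    by (intro comp_r_uniform_limit[OF compact_K order_refl order_refl directed]) (auto simp: f)
  then obtain s where s: "\<And>n. s n \<in> \<Gamma>"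
    "\<And>n t x. t \<in> \<Gamma> \<Longrightarrow> le (s n) t \<Longrightarrow> x \<in> K \<Longrightarrow> \<bar>f (r t x) - f x\<bar> < inverse (real (Suc n))"
    by metis
  obtain u where u: "u \<in> \<Gamma>" "\<And>n. le (s n) u"
    by (rule countable_upper_bound[of "range s" "s 0"]) (use s(1) in auto)
  have "f (r u x) = f x" if "x \<in> K" for x
  proof (rule ccontr)
    assume "f (r u x) \<noteq> f x"
    then have "0 < \<bar>f (r u x) - f x\<bar>" by simp
    then obtain n where "inverse (real (Suc n)) < \<bar>f (r u x) - f x\<bar>"
      using reals_Archimedean by blast
    with s(2)[OF u(1) u(2)[of n] that] show False by linarith
  qed
  with u(1) show ?thesis by blast
qed

text \<open>On \<open>r u[K]\<close> the maps \<open>r (s n)\<close> converge pointwise to the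
  identity, hence separate points, and the previous uniform estimate applies there. It transfers to
  all of \<open>K\<close> because \<open>r (s n) \<circ> r u = r (s n)\<close>.\<close>

lemma comp_r_seq_uniform_limit:
  fixes f :: "'a \<Rightarrow> real"
  assumes s: "increasing_seq \<Gamma> le s" "is_supremum \<Gamma> le (range s) u"
    and f: "continuous_on K f" and e: "e > 0"
  shows "\<exists>N. \<forall>n\<ge>N. \<forall>x\<in>K. \<bar>f (r (s n) x) - f (r u x)\<bar> < e"
proof -
  have sG: "s n \<in> \<Gamma>" for n
    using s(1) by (simp add: increasing_seq_def)
  note u = is_supremumD[OF s(2)]
  have "\<exists>p\<in>range s. \<forall>t\<in>range s. le p t \<longrightarrow> (\<forall>x\<in>r u ` K. \<bar>f (r t x) - f x\<bar> < e)"
  proof (rule comp_r_uniform_limit)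
    show "compact (r u ` K)" "r u ` K \<subseteq> K"
      using u r_image_compact r_image_subset by auto
    show "range s \<subseteq> \<Gamma>"
      using sG by blast
    show "up_directed (range s) le"
      unfolding up_directed_def using seq_mono[OF s(1)]
      by (auto, metis nat_le_linear)
    show "r t x \<in> r u ` K" if "t \<in> range s" "x \<in> r u ` K" for t x
      using that sG u r_image_mono r_image_subset by (metis imageI image_iff subsetD)
    show "\<exists>t\<in>range s. r t x \<noteq> r t y" if xy: "x \<in> r u ` K" "y \<in> r u ` K" "x \<noteq> y" for x y
    proof (rule ccontr)
      assume "\<not> ?thesis"
      then have "(\<lambda>n. r (s n) x) = (\<lambda>n. r (s n) y)" by auto
      moreover have "(\<lambda>n. r (s n) x) \<longlonglongrightarrow> x" "(\<lambda>n. r (s n) y) \<longlonglongrightarrow> y"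
        using r_seq_limit[OF s] xy r_image_iff[OF u(1)] by metis+
      ultimately show False
        using xy(3) LIMSEQ_unique by metis
    qed
    show "continuous_on (r u ` K) f"
      using f r_image_subset u(1) continuous_on_subset by blast
  qed (rule e)
  then obtain N where N: "\<And>n x. le (s N) (s n) \<Longrightarrow> x \<in> r u ` K \<Longrightarrow> \<bar>f (r (s n) x) - f x\<bar> < e"
    by blast
  have "\<bar>f (r (s n) x) - f (r u x)\<bar> < e" if "n \<ge> N" "x \<in> K" for n x
    using N[OF seq_mono[OF s(1) that(1)], of "r u x"] that(2) r_absorb(2)[OF sG u(1) u(2)] by simp
  then show ?thesis by blast
qed

section \<open>Limits along directed subsets of the index set\<close>

lemma closed_K: "closed K"
  using compact_K by (rule compact_imp_closed)

text \<open>If this failed, \<open>\<Lambda>\<close> would contain an increasing sequence with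
  successive jumps of size at least \<open>e\<close>, contradicting uniform convergence towards its
  supremum. That supremum is taken in \<open>\<Gamma>\<close> and may lie outside
  \<open>\<Lambda>\<close>.\<close>

lemma comp_r_oscillation:
  fixes f :: "'a \<Rightarrow> real"
  assumes \<Lambda>: "\<Lambda> \<subseteq> \<Gamma>" "up_directed \<Lambda> le" and f: "continuous_on K f" and e: "e > 0"
  shows "\<exists>s\<in>\<Lambda>. \<forall>t\<in>\<Lambda>. le s t \<longrightarrow> (\<forall>x\<in>K. \<bar>f (r t x) - f (r s x)\<bar> < e)"
proof (rule ccontr)
  assume "\<not> ?thesis"
  then have step: "\<exists>t. t \<in> \<Lambda> \<and> le s t \<and> (\<exists>x\<in>K. \<bar>f (r t x) - f (r s x)\<bar> \<ge> e)" if "s \<in> \<Lambda>" for s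
    using that by (meson not_less)
  obtain s\<^sub>0 where "s\<^sub>0 \<in> \<Lambda>"
    using \<Lambda>(2) by (auto simp: up_directed_def)
  then have "\<exists>s. \<forall>n. s n \<in> \<Lambda> \<and> le (s n) (s (Suc n)) \<and> (\<exists>x\<in>K. \<bar>f (r (s (Suc n)) x) - f (r (s n) x)\<bar> \<ge> e)"
    using step by (intro dependent_nat_choice[of "\<lambda>_ s. s \<in> \<Lambda>"
      "\<lambda>_ s t. le s t \<and> (\<exists>x\<in>K. \<bar>f (r t x) - f (r s x)\<bar> \<ge> e)", simplified]) blast+
  then obtain s where s: "\<And>n. s n \<in> \<Lambda>" "\<And>n. le (s n) (s (Suc n))"
    "\<And>n. \<exists>x\<in>K. \<bar>f (r (s (Suc n)) x) - f (r (s n) x)\<bar> \<ge> e"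
    by blast
  then have inc: "increasing_seq \<Gamma> le s"
    using \<Lambda>(1) by (auto simp: increasing_seq_def)
  then obtain u where u: "is_supremum \<Gamma> le (range s) u"
    using sup_exists by blast
  obtain N where N: "\<forall>n\<ge>N. \<forall>x\<in>K. \<bar>f (r (s n) x) - f (r u x)\<bar> < e / 2"
    using comp_r_seq_uniform_limit[OF inc u f, of "e / 2"] e by auto
  obtain x where x: "x \<in> K" "\<bar>f (r (s (Suc N)) x) - f (r (s N) x)\<bar> \<ge> e"
    using s(3) by blast
  have "\<bar>f (r (s N) x) - f (r u x)\<bar> < e / 2" "\<bar>f (r (s (Suc N)) x) - f (r u x)\<bar> < e / 2"
    using N x(1) by simp_all
  with x(2) show False by linarith
qed

text \<open>Compactness supplies a cluster point \<open>y\<close> of the net, and the small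
  oscillation of real functions along the net turns it into a limit.\<close>

lemma directed_limit_exists:
  assumes \<Lambda>: "\<Lambda> \<subseteq> \<Gamma>" "up_directed \<Lambda> le" and x: "x \<in> K"
  shows "\<exists>y\<in>K. ((\<lambda>s. r s x) \<longlongrightarrow> y) (net_filter \<Lambda> le)"
proof -
  note ev = eventually_net_filter[OF \<Lambda>(2) transp_on[OF \<Lambda>(1)]]
  let ?F = "filtermap (\<lambda>s. r s x) (net_filter \<Lambda> le)"
  obtain s\<^sub>0 where s\<^sub>0: "s\<^sub>0 \<in> \<Lambda>"
    using \<Lambda>(2) by (auto simp: up_directed_def)
  have "?F \<noteq> bot"
    using net_filter_neq_bot[OF \<Lambda>(2) transp_on[OF \<Lambda>(1)]] by (simp add: filtermap_bot_iff)
  moreover have "eventually (\<lambda>z. z \<in> K) ?F"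
    unfolding eventually_filtermap ev using s\<^sub>0 \<Lambda>(1) r_in_K x by blast
  ultimately obtain y where y: "y \<in> K" "inf (nhds y) ?F \<noteq> bot"
    using compact_K unfolding compact_filter by blast
  have cluster: "\<exists>t\<in>\<Lambda>. le s t \<and> r t x \<in> V" if s: "s \<in> \<Lambda>" and V: "open V" "y \<in> V" for s V
  proof (rule ccontr)
    assume neg: "\<not> ?thesis"
    have "eventually (\<lambda>z. z \<in> V) (nhds y)"
      using V by (rule eventually_nhds_in_open)
    moreover have "eventually (\<lambda>z. z \<notin> V) ?F"
      unfolding eventually_filtermap ev using s neg by blast
    ultimately have "eventually (\<lambda>z. False) (inf (nhds y) ?F)"
      unfolding eventually_inf by blast
    with y(2) show False
      by (simp add: trivial_limit_def)
  qed
  have "eventually (\<lambda>s. r s x \<in> W) (net_filter \<Lambda> le)" if W: "open W" "y \<in> W" for W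
  proof -
    obtain f :: "'a \<Rightarrow> real" where f: "continuous_on K f" "f y = 1"
      "\<And>z. z \<in> K \<Longrightarrow> z \<notin> W \<Longrightarrow> f z = 0"
      by (rule compact_Urysohn[OF compact_K y(1) W(2,1)]) blast
    \<comment> \<open>Some later \<open>r t x\<close> has \<open>f\<close>-value above 2/3; two
      oscillations below 1/3 each keep \<open>f\<close> positive on the whole tail, which therefore
      stays in \<open>W\<close>.\<close>
    obtain s where s: "s \<in> \<Lambda>" "\<forall>t\<in>\<Lambda>. le s t \<longrightarrow> (\<forall>x\<in>K. \<bar>f (r t x) - f (r s x)\<bar> < 1 / 3)"
      using comp_r_oscillation[OF \<Lambda> f(1), of "1/3"] by auto
    obtain V where V: "open V" "V \<inter> K = f -` {2/3<..} \<inter> K"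
      using f(1)[unfolded continuous_on_open_invariant, rule_format, of "{2/3<..}"] by auto
    then have "y \<in> V"
      using f(2) y(1) by auto
    from cluster[OF s(1) V(1) this] obtain t where t: "t \<in> \<Lambda>" "le s t" "r t x \<in> V"
      by blast
    then have ft: "f (r t x) > 2/3"
      using V(2) r_in_K \<Lambda>(1) x by blast
    have "r p x \<in> W" if p: "p \<in> \<Lambda>" "le s p" for p
    proof (rule ccontr)
      assume "r p x \<notin> W"
      then have "f (r p x) = 0"
        using f(3) r_in_K p(1) \<Lambda>(1) x by blast
      moreover have "\<bar>f (r p x) - f (r s x)\<bar> < 1 / 3" "\<bar>f (r t x) - f (r s x)\<bar> < 1 / 3"
        using s(2) p t x by blast+
      ultimately show False
        using ft by linarith
    qed
    then show ?thesis
      unfolding ev using s(1) by blast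
  qed
  with y(1) show ?thesis
    unfolding tendsto_def by blast
qed

text \<open>This is the projection \<open>R\<^sub>\<Lambda>\<close> of the overview. For directed
  \<open>\<Lambda> \<subseteq> \<Gamma>\<close> and \<open>x \<in> K\<close> the limit exists and is
  unique, so the choice is determined.\<close>

definition directed_limit :: "'i set \<Rightarrow> 'a \<Rightarrow> 'a" where
  "directed_limit \<Lambda> x = (SOME y. y \<in> K \<and> ((\<lambda>s. r s x) \<longlongrightarrow> y) (net_filter \<Lambda> le))"

lemma
  assumes "\<Lambda> \<subseteq> \<Gamma>" "up_directed \<Lambda> le" "x \<in> K"
  shows directed_limit_in_K: "directed_limit \<Lambda> x \<in> K"
    and tendsto_directed_limit: "((\<lambda>s. r s x) \<longlongrightarrow> directed_limit \<Lambda> x) (net_filter \<Lambda> le)"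
proof -
  have "\<exists>y. y \<in> K \<and> ((\<lambda>s. r s x) \<longlongrightarrow> y) (net_filter \<Lambda> le)"
    using directed_limit_exists[OF assms] by blast
  from someI_ex[OF this]
  show "directed_limit \<Lambda> x \<in> K" "((\<lambda>s. r s x) \<longlongrightarrow> directed_limit \<Lambda> x) (net_filter \<Lambda> le)"
    by (simp_all add: directed_limit_def)
qed

lemma directed_limit_unique:
  assumes "\<Lambda> \<subseteq> \<Gamma>" "up_directed \<Lambda> le" "x \<in> K" "((\<lambda>s. r s x) \<longlongrightarrow> y) (net_filter \<Lambda> le)"
  shows "directed_limit \<Lambda> x = y"
  using tendsto_unique[OF net_filter_neq_bot[OF assms(2) transp_on[OF assms(1)]]
      tendsto_directed_limit[OF assms(1-3)] assms(4)] .

lemma directed_limit_eventually_const: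
  assumes \<Lambda>: "\<Lambda> \<subseteq> \<Gamma>" "up_directed \<Lambda> le" and "x \<in> K"
    and s: "s \<in> \<Lambda>" "\<And>t. t \<in> \<Lambda> \<Longrightarrow> le s t \<Longrightarrow> r t x = y"
  shows "directed_limit \<Lambda> x = y"
proof (rule directed_limit_unique[OF assms(1-3)])
  have "\<forall>\<^sub>F t in net_filter \<Lambda> le. r t x = y"
    unfolding eventually_net_filter[OF \<Lambda>(2) transp_on[OF \<Lambda>(1)]] using s by blast
  then show "((\<lambda>s. r s x) \<longlongrightarrow> y) (net_filter \<Lambda> le)"
    by (rule tendsto_eventually)
qed

lemma directed_limit_cong:
  assumes \<Lambda>: "\<Lambda> \<subseteq> \<Gamma>" "up_directed \<Lambda> le" and xy: "x \<in> K" "y \<in> K"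
    and eq: "\<And>s. s \<in> \<Lambda> \<Longrightarrow> r s x = r s y"
  shows "directed_limit \<Lambda> x = directed_limit \<Lambda> y"
proof (rule directed_limit_unique[OF \<Lambda> xy(1)])
  have "\<forall>\<^sub>F t in net_filter \<Lambda> le. r t y = r t x"
    unfolding eventually_net_filter[OF \<Lambda>(2) transp_on[OF \<Lambda>(1)]]
    using eq \<Lambda>(2) by (auto simp: up_directed_def)
  with tendsto_directed_limit[OF \<Lambda> xy(2)]
  show "((\<lambda>s. r s x) \<longlongrightarrow> directed_limit \<Lambda> y) (net_filter \<Lambda> le)"
    by (rule Lim_transform_eventually)
qed

text \<open>Let \<open>t\<close> tend to its limit along \<open>\<Lambda>\<close> in the oscillation
  bound, which holds uniformly in \<open>x\<close>.\<close>

lemma comp_directed_limit_uniform: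
  fixes f :: "'a \<Rightarrow> real"
  assumes \<Lambda>: "\<Lambda> \<subseteq> \<Gamma>" "up_directed \<Lambda> le" and f: "continuous_on K f" and e: "e > 0"
  shows "\<exists>s\<in>\<Lambda>. \<forall>x\<in>K. \<bar>f (r s x) - f (directed_limit \<Lambda> x)\<bar> < e"
proof -
  obtain s where s: "s \<in> \<Lambda>" "\<And>t x. t \<in> \<Lambda> \<Longrightarrow> le s t \<Longrightarrow> x \<in> K \<Longrightarrow> \<bar>f (r t x) - f (r s x)\<bar> < e / 2"
    using comp_r_oscillation[OF \<Lambda> f, of "e / 2"] e by auto
  have "\<bar>f (r s x) - f (directed_limit \<Lambda> x)\<bar> < e" if x: "x \<in> K" for x
  proof -
    note ev = eventually_net_filter[OF \<Lambda>(2) transp_on[OF \<Lambda>(1)]]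
    have "\<forall>\<^sub>F t in net_filter \<Lambda> le. r t x \<in> K"
      unfolding ev using s(1) r_in_K x \<Lambda>(1) by blast
    then have "((\<lambda>t. f (r t x)) \<longlongrightarrow> f (directed_limit \<Lambda> x)) (net_filter \<Lambda> le)"
      using directed_limit_in_K[OF \<Lambda> x] tendsto_directed_limit[OF \<Lambda> x]
      by (intro continuous_on_tendsto_compose[OF f])
    then have "((\<lambda>t. \<bar>f (r t x) - f (r s x)\<bar>) \<longlongrightarrow> \<bar>f (directed_limit \<Lambda> x) - f (r s x)\<bar>)
        (net_filter \<Lambda> le)"
      by (intro tendsto_intros)
    moreover have "\<forall>\<^sub>F t in net_filter \<Lambda> le. \<bar>f (r t x) - f (r s x)\<bar> \<le> e / 2"
      unfolding ev using s x by (intro bexI[of _ s]) (auto intro: less_imp_le)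
    ultimately have "\<bar>f (directed_limit \<Lambda> x) - f (r s x)\<bar> \<le> e / 2"
      by (intro tendsto_upperbound[OF _ _ net_filter_neq_bot[OF \<Lambda>(2) transp_on[OF \<Lambda>(1)]]])
    with e show ?thesis by linarith
  qed
  with s(1) show ?thesis by blast
qed

text \<open>A uniform limit of functions \<open>f \<circ> r (s n)\<close>, where \<open>s n\<close>
  is an index chosen for the error \<open>1 / (n + 1)\<close>.\<close>

lemma comp_directed_limit_continuous:
  fixes f :: "'a \<Rightarrow> real"
  assumes \<Lambda>: "\<Lambda> \<subseteq> \<Gamma>" "up_directed \<Lambda> le" and f: "continuous_on K f"
  shows "continuous_on K (\<lambda>x. f (directed_limit \<Lambda> x))"
proof -
  have "\<forall>n::nat. \<exists>s\<in>\<Lambda>. \<forall>x\<in>K. \<bar>f (r s x) - f (directed_limit \<Lambda> x)\<bar> < inverse (Suc n)"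
    using comp_directed_limit_uniform[OF \<Lambda> f] by simp
  then obtain s where s: "\<And>n. s n \<in> \<Lambda>"
    "\<And>n x. x \<in> K \<Longrightarrow> \<bar>f (r (s n) x) - f (directed_limit \<Lambda> x)\<bar> < inverse (real (Suc n))"
    by metis
  show ?thesis
  proof (rule uniform_limit_theorem)
    show "\<forall>\<^sub>F n in sequentially. continuous_on K (\<lambda>x. f (r (s n) x))"
      using comp_r_continuous[OF f] s(1) \<Lambda>(1) by (auto intro: always_eventually)
    show "uniform_limit K (\<lambda>n x. f (r (s n) x)) (\<lambda>x. f (directed_limit \<Lambda> x)) sequentially"
      unfolding uniform_limit_iff
    proof (intro allI impI)
      fix e :: real assume "e > 0"
      then have "\<forall>\<^sub>F n in sequentially. inverse (real (Suc n)) < e"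
        by (rule order_tendstoD(2)[OF LIMSEQ_inverse_real_of_nat])
      then show "\<forall>\<^sub>F n in sequentially. \<forall>x\<in>K. dist (f (r (s n) x)) (f (directed_limit \<Lambda> x)) < e"
        by eventually_elim (auto simp: dist_real_def intro: less_trans[OF s(2)])
    qed
  qed simp
qed

text \<open>Pass to the limit over \<open>t\<close> in \<open>r s (r t x) = r s x\<close>, valid for
  all \<open>t\<close> beyond \<open>s\<close>.\<close>

lemma r_directed_limit:
  assumes \<Lambda>: "\<Lambda> \<subseteq> \<Gamma>" "up_directed \<Lambda> le" and x: "x \<in> K" and s: "s \<in> \<Lambda>"
  shows "r s (directed_limit \<Lambda> x) = r s x"
proof -
  note ev = eventually_net_filter[OF \<Lambda>(2) transp_on[OF \<Lambda>(1)]]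
  have sG: "s \<in> \<Gamma>" using s \<Lambda>(1) by blast
  have "\<forall>\<^sub>F t in net_filter \<Lambda> le. r t x \<in> K"
    unfolding ev using s r_in_K x \<Lambda>(1) by blast
  then have "((\<lambda>t. r s (r t x)) \<longlongrightarrow> r s (directed_limit \<Lambda> x)) (net_filter \<Lambda> le)"
    using directed_limit_in_K[OF \<Lambda> x] tendsto_directed_limit[OF \<Lambda> x]
    by (intro continuous_on_tendsto_compose[OF r_continuous[OF sG]])
  moreover have "\<forall>\<^sub>F t in net_filter \<Lambda> le. r s (r t x) = r s x"
    unfolding ev using s r_absorb(2)[OF sG _ _ x] \<Lambda>(1) by blast
  then have "((\<lambda>t. r s (r t x)) \<longlongrightarrow> r s x) (net_filter \<Lambda> le)"
    by (rule tendsto_eventually)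
  ultimately show ?thesis
    by (rule tendsto_unique[OF net_filter_neq_bot[OF \<Lambda>(2) transp_on[OF \<Lambda>(1)]]])
qed

lemma directed_limit_fixed:
  assumes \<Lambda>: "\<Lambda> \<subseteq> \<Gamma>" "up_directed \<Lambda> le" and s: "s \<in> \<Lambda>" and x: "x \<in> r s ` K"
  shows "directed_limit \<Lambda> x = x"
proof (rule directed_limit_eventually_const[OF \<Lambda> _ s])
  show "x \<in> K"
    using x s \<Lambda>(1) r_image_subset by blast
  fix t assume "t \<in> \<Lambda>" "le s t"
  then show "r t x = x"
    using x s \<Lambda>(1) r_image_mono r_image_iff by blast
qed

text \<open>A limit along \<open>\<Lambda>\<close> depends only on the values \<open>r s x\<close>
  with \<open>s \<in> \<Lambda>\<close>, and the projection for the larger \<open>\<Lambda>'\<close>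
  does not change these.\<close>

lemma directed_limit_absorb:
  assumes "\<Lambda> \<subseteq> \<Lambda>'" "\<Lambda>' \<subseteq> \<Gamma>" "up_directed \<Lambda> le" "up_directed \<Lambda>' le" and x: "x \<in> K"
  shows "directed_limit \<Lambda> (directed_limit \<Lambda>' x) = directed_limit \<Lambda> x"
  using assms r_directed_limit[OF assms(2,4) x] directed_limit_in_K
  by (intro directed_limit_cong) auto

text \<open>Each point of \<open>C\<close> is fixed, so every continuous real \<open>f\<close>
  agrees with its composition with the projection on \<open>C\<close>, hence at \<open>y\<close>;
  such functions separate points.\<close>

lemma directed_limit_fixed_closure:
  assumes \<Lambda>: "\<Lambda> \<subseteq> \<Gamma>" "up_directed \<Lambda> le" and C: "C \<subseteq> (\<Union>s\<in>\<Lambda>. r s ` K)" and y: "y \<in> closure C"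
  shows "directed_limit \<Lambda> y = y"
proof (rule ccontr)
  assume neq: "directed_limit \<Lambda> y \<noteq> y"
  have CK: "C \<subseteq> K"
    using C \<Lambda>(1) r_image_subset by blast
  then have yK: "y \<in> K"
    using y closure_minimal[OF _ closed_K] by blast
  then obtain f :: "'a \<Rightarrow> real" where f: "continuous_on K f" "f (directed_limit \<Lambda> y) \<noteq> f y"
    using compact_Urysohn_separate[OF compact_K directed_limit_in_K[OF \<Lambda> yK] yK neq] by metis
  have "f (directed_limit \<Lambda> y) = f y"
  proof (rule eq_on_closure[OF closed_K _ f(1) CK _ y])
    show "continuous_on K (\<lambda>x. f (directed_limit \<Lambda> x))"
      by (rule comp_directed_limit_continuous[OF \<Lambda> f(1)])
    show "f (directed_limit \<Lambda> x) = f x" if "x \<in> C" for x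
      using directed_limit_fixed[OF \<Lambda>] that C by fastforce
  qed
  with f(2) show False by simp
qed

section \<open>Countable subsets and countable tightness of the induced set\<close>

lemma induced_set_countable_subset:
  assumes "countable C" "C \<subseteq> induced_set K \<Gamma> r" "s \<in> \<Gamma>"
  obtains t where "t \<in> \<Gamma>" "le s t" "C \<subseteq> r t ` K"
proof -
  have "\<forall>c\<in>C. \<exists>p\<in>\<Gamma>. c \<in> r p ` K"
    using assms(2) unfolding induced_set_def by blast
  then obtain p where p: "\<And>c. c \<in> C \<Longrightarrow> p c \<in> \<Gamma>" "\<And>c. c \<in> C \<Longrightarrow> c \<in> r (p c) ` K"
    by metis
  obtain t where t: "t \<in> \<Gamma>" "le s t" "\<And>q. q \<in> p ` C \<Longrightarrow> le q t"
    by (rule countable_upper_bound[of "p ` C" s]) (use assms p in auto)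
  then have "C \<subseteq> r t ` K"
    using p r_image_mono by blast
  with t that show ?thesis by blast
qed

text \<open>An increasing sequence of indices is built together with countable sets
  \<open>C n \<subseteq> B\<close> whose images under \<open>r (s n)\<close> are dense in that of
  \<open>B\<close>. With \<open>u\<close> the supremum, \<open>r u\<close> fixes every
  \<open>C n\<close>, and uniform convergence of \<open>f \<circ> r (s n)\<close> shows that no
  neighbourhood of \<open>y\<close> misses all the \<open>C n\<close>.\<close>

lemma induced_set_countable_tightness:
  assumes B: "B \<subseteq> induced_set K \<Gamma> r" and y: "y \<in> induced_set K \<Gamma> r" "y \<in> closure B"
  obtains C where "countable C" "C \<subseteq> B" "y \<in> closure C"
proof -
  have BK: "B \<subseteq> K"
    using B r_image_subset by (auto simp: induced_set_def)
  have clB: "closure B \<subseteq> K"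
    using BK closed_K by (rule closure_minimal)
  \<comment> \<open>\<open>C\<close> is dense in \<open>B\<close> as far as \<open>r s\<close> can
    see, and the next index \<open>t\<close> already fixes all points of \<open>C\<close>.\<close>
  define good where "good s t C \<longleftrightarrow> countable C \<and> C \<subseteq> B \<and> r s ` B \<subseteq> closure (r s ` C) \<and> C \<subseteq> r t ` K"
    for s t C
  obtain s\<^sub>0 where s\<^sub>0: "s\<^sub>0 \<in> \<Gamma>" "y \<in> r s\<^sub>0 ` K"
    using y(1) by (auto simp: induced_set_def)
  have "\<exists>t\<in>\<Gamma>. le s t \<and> (\<exists>C. good s t C)" if s: "s \<in> \<Gamma>" for s
  proof -
    obtain C' where C': "countable C'" "C' \<subseteq> r s ` B" "r s ` B \<subseteq> closure C'"
      by (rule second_countable_dense_subset[OF r_image_second_countable[OF s], of "r s ` B"])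
        (use BK in blast)
    then obtain C where C: "countable C" "C \<subseteq> B" "C' = r s ` C"
      using countable_subset_image by metis
    obtain t where "t \<in> \<Gamma>" "le s t" "C \<subseteq> r t ` K"
      by (rule induced_set_countable_subset[OF C(1) _ s]) (use C(2) B in blast)
    with C C' show ?thesis
      unfolding good_def by blast
  qed
  then obtain s u where s: "s 0 = s\<^sub>0" "increasing_seq \<Gamma> le s" "is_supremum \<Gamma> le (range s) u"
      "\<And>n. \<exists>C. good (s n) (s (Suc n)) C"
    by (rule increasing_sequence_from[OF s\<^sub>0(1)]) blast+
  then obtain C where C: "\<And>n. good (s n) (s (Suc n)) (C n)"
    by metis
  have sG: "s n \<in> \<Gamma>" for n
    using s(2) by (simp add: increasing_seq_def)
  note u = is_supremumD[OF s(3)]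
  show ?thesis
  proof
    show "countable (\<Union>n. C n)" "(\<Union>n. C n) \<subseteq> B"
      using C unfolding good_def by (simp, blast)
    have "W \<inter> (\<Union>n. C n) \<noteq> {}" if W: "open W" "y \<in> W" for W
    proof
      assume disj: "W \<inter> (\<Union>n. C n) = {}"
      have yK: "y \<in> K"
        using y(2) clB by blast
      obtain f :: "'a \<Rightarrow> real" where f: "continuous_on K f" "f y = 1"
          "\<And>z. z \<in> K \<Longrightarrow> z \<notin> W \<Longrightarrow> f z = 0"
        by (rule compact_Urysohn[OF compact_K yK W(2,1)]) blast
      obtain N where N: "\<And>n x. n \<ge> N \<Longrightarrow> x \<in> K \<Longrightarrow> \<bar>f (r (s n) x) - f (r u x)\<bar> < 1 / 2"
        using comp_r_seq_uniform_limit[OF s(2,3) f(1), of "1/2"] by auto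
      have CN: "C N \<subseteq> B" "r (s N) ` B \<subseteq> closure (r (s N) ` C N)" "C N \<subseteq> r (s (Suc N)) ` K"
        using C[of N] by (auto simp: good_def)
      have "f (r (s N) c) \<le> 1 / 2" if c: "c \<in> C N" for c
      proof -
        have "c \<in> r u ` K"
          using c CN(3) r_image_mono[OF sG u] by blast
        then have "r u c = c"
          using r_image_iff u by blast
        moreover have "c \<in> K" "c \<notin> W"
          using c CN(1) BK disj by blast+
        ultimately show ?thesis
          using N[of N c] f(3)[of c] by simp
      qed
      then have "r (s N) ` C N \<subseteq> K \<inter> f -` {..1/2}"
        using CN(1) BK r_in_K sG by auto
      then have cl: "closure (r (s N) ` C N) \<subseteq> K \<inter> f -` {..1/2}"
        by (intro closure_minimal continuous_closed_preimage f(1) closed_K) auto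
      \<comment> \<open>As \<open>r (s N)\<close> fixes \<open>y\<close>, continuity carries
        \<open>y \<in> closure B\<close> into the closure of the image of \<open>C N\<close>, where
        \<open>f\<close> is at most 1/2; but \<open>f y = 1\<close>.\<close>
      have "r (s N) ` closure B \<subseteq> closure (r (s N) ` C N)"
        using CN(2) continuous_on_subset[OF r_continuous[OF sG] clB]
        by (intro image_closure_subset) auto
      moreover have "le s\<^sub>0 (s N)"
        using seq_mono[OF s(2), of 0 N] s(1) by simp
      then have "r (s N) y = y"
        using s\<^sub>0 sG r_image_mono r_image_iff by blast
      ultimately have "y \<in> closure (r (s N) ` C N)"
        using y(2) by force
      with cl f(2) show False by auto
    qed
    then show "y \<in> closure (\<Union>n. C n)"
      unfolding closure_iff_nhds_not_empty by (metis Int_commute inf.orderE inf_assoc inf_bot_right)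
  qed
qed

section \<open>Commutative subskeletons\<close>

lemma subskeleton_directed:
  assumes "subskeleton_index \<Gamma> le \<Gamma>'"
  shows "up_directed \<Gamma>' le"
  unfolding up_directed_def
proof (intro conjI ballI)
  have sub: "\<Gamma>' \<subseteq> \<Gamma>" and cof: "\<And>s. s \<in> \<Gamma> \<Longrightarrow> \<exists>t\<in>\<Gamma>'. le s t"
    using assms by (auto simp: subskeleton_index_def)
  show "\<Gamma>' \<noteq> {}"
    using cof directed by (auto simp: up_directed_def)
  fix s t assume st: "s \<in> \<Gamma>'" "t \<in> \<Gamma>'"
  then obtain u where u: "u \<in> \<Gamma>" "le s u" "le t u"
    using upper_bound sub by blast
  then obtain v where v: "v \<in> \<Gamma>'" "le u v"
    using cof by blast
  have "le s v" "le t v"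
    using le_trans u v st sub by blast+
  with v(1) show "\<exists>u\<in>\<Gamma>'. le s u \<and> le t u" by blast
qed

text \<open>Cofinality makes the net over \<open>\<Gamma>'\<close> a subnet of the one over
  \<open>\<Gamma>\<close>, which converges to \<open>x\<close>.\<close>

lemma directed_limit_subskeleton:
  assumes \<Gamma>': "subskeleton_index \<Gamma> le \<Gamma>'" and x: "x \<in> K"
  shows "directed_limit \<Gamma>' x = x"
proof (rule directed_limit_unique[OF _ subskeleton_directed[OF \<Gamma>'] x])
  have sub: "\<Gamma>' \<subseteq> \<Gamma>" and cof: "\<And>s. s \<in> \<Gamma> \<Longrightarrow> \<exists>t\<in>\<Gamma>'. le s t"
    using \<Gamma>' by (auto simp: subskeleton_index_def)
  show "\<Gamma>' \<subseteq> \<Gamma>" by (rule sub)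
  show "((\<lambda>s. r s x) \<longlongrightarrow> x) (net_filter \<Gamma>' le)"
  proof (rule filterlim_mono[OF r_net_limit[OF x] order_refl], rule filter_leI)
    fix P assume "eventually P (net_filter \<Gamma> le)"
    then obtain s where s: "s \<in> \<Gamma>" "\<And>t. t \<in> \<Gamma> \<Longrightarrow> le s t \<Longrightarrow> P t"
      unfolding eventually_net_filter[OF directed transp_on[OF order_refl]] by blast
    obtain t where t: "t \<in> \<Gamma>'" "le s t"
      using cof s(1) by blast
    then have "P u" if "u \<in> \<Gamma>'" "le t u" for u
      using that s le_trans[of s t u] sub by blast
    with t(1) show "eventually P (net_filter \<Gamma>' le)"
      unfolding eventually_net_filter[OF subskeleton_directed[OF \<Gamma>'] transp_on[OF sub]] by blast
  qed
qed

text \<open>The point is that suprema of increasing sequences agree in \<open>\<Gamma>'\<close> and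
  in \<open>\<Gamma>\<close>; the other axioms are inherited or follow from cofinality.\<close>

lemma retractional_skeleton_subskeleton:
  assumes \<Gamma>': "subskeleton_index \<Gamma> le \<Gamma>'"
  shows "retractional_skeleton K \<Gamma>' le r"
proof -
  have sub: "\<Gamma>' \<subseteq> \<Gamma>" and clo: "\<And>s u. increasing_seq \<Gamma>' le s \<Longrightarrow> is_supremum \<Gamma> le (range s) u \<Longrightarrow> u \<in> \<Gamma>'"
    using \<Gamma>' by (auto simp: subskeleton_index_def)
  have inc: "increasing_seq \<Gamma> le s" if "increasing_seq \<Gamma>' le s" for s
    using that sub by (auto simp: increasing_seq_def)
  have sup: "is_supremum \<Gamma>' le (range s) u"
    if s: "increasing_seq \<Gamma>' le s" and u: "is_supremum \<Gamma> le (range s) u" for s u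
    using clo[OF s u] u sub unfolding is_supremum_def by blast
  \<comment> \<open>The supremum in \<open>\<Gamma>\<close> lies in \<open>\<Gamma>'\<close> and is
    a supremum there as well, so by antisymmetry it is the given one.\<close>
  have sup': "is_supremum \<Gamma> le (range s) u"
    if s: "increasing_seq \<Gamma>' le s" and u: "is_supremum \<Gamma>' le (range s) u" for s u
  proof -
    obtain v where v: "is_supremum \<Gamma> le (range s) v"
      using sup_exists[OF inc[OF s]] by blast
    then have "is_supremum \<Gamma>' le (range s) v"
      by (rule sup[OF s])
    with u sub have "u = v"
      unfolding is_supremum_def by (intro le_antisym) auto
    with v show ?thesis by simp
  qed
  have "partially_ordered \<Gamma>' le"
    using skeleton sub unfolding retractional_skeleton_def partially_ordered_def
    by (meson reflp_on_subset transp_on_subset antisymp_on_subset)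
  moreover have "sigma_complete \<Gamma>' le"
    unfolding sigma_complete_def using sup sup_exists inc by blast
  moreover have "((\<lambda>s. r s x) \<longlongrightarrow> x) (net_filter \<Gamma>' le)" if "x \<in> K" for x
    using tendsto_directed_limit[OF sub subskeleton_directed[OF \<Gamma>'] that]
      directed_limit_subskeleton[OF \<Gamma>' that] by simp
  ultimately show ?thesis
    using skeleton subskeleton_directed[OF \<Gamma>'] sub inc sup'
    unfolding retractional_skeleton_def by (simp add: subset_iff)
qed

lemma induced_set_subskeleton:
  assumes \<Gamma>': "subskeleton_index \<Gamma> le \<Gamma>'"
  shows "induced_set K \<Gamma>' r = induced_set K \<Gamma> r"
proof
  have sub: "\<Gamma>' \<subseteq> \<Gamma>" and cof: "\<And>s. s \<in> \<Gamma> \<Longrightarrow> \<exists>t\<in>\<Gamma>'. le s t"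
    using \<Gamma>' by (auto simp: subskeleton_index_def)
  show "induced_set K \<Gamma>' r \<subseteq> induced_set K \<Gamma> r"
    using sub by (auto simp: induced_set_def)
  show "induced_set K \<Gamma> r \<subseteq> induced_set K \<Gamma>' r"
    unfolding induced_set_def
  proof (rule UN_least)
    fix s assume s: "s \<in> \<Gamma>"
    then obtain t where t: "t \<in> \<Gamma>'" "le s t"
      using cof by blast
    have "r s ` K \<subseteq> r t ` K"
      using s t sub by (intro r_image_mono) auto
    also have "\<dots> \<subseteq> (\<Union>s\<in>\<Gamma>'. r s ` K)"
      using t(1) by (rule UN_upper)
    finally show "r s ` K \<subseteq> (\<Union>s\<in>\<Gamma>'. r s ` K)" .
  qed
qed

lemma commutative_subskeleton_imp_induced:
  fixes I :: "'i itself"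
  assumes "has_commutative_subskeleton K \<Gamma> le r"
  shows "induced_by_commutative_skeleton I K (induced_set K \<Gamma> r)"
  using assms retractional_skeleton_subskeleton induced_set_subskeleton
  unfolding has_commutative_subskeleton_def induced_by_commutative_skeleton_def by metis

lemma induced_set_dense: "K \<subseteq> closure (induced_set K \<Gamma> r)"
proof
  fix x assume x: "x \<in> K"
  have "r s x \<in> closure (induced_set K \<Gamma> r)" if "s \<in> \<Gamma>" for s
    using that x closure_subset[of "induced_set K \<Gamma> r"] unfolding induced_set_def by blast
  then have "\<forall>\<^sub>F s in net_filter \<Gamma> le. r s x \<in> closure (induced_set K \<Gamma> r)"
    unfolding eventually_net_filter[OF directed transp_on[OF order_refl]]
    using directed by (auto simp: up_directed_def)
  with r_net_limit[OF x] show "x \<in> closure (induced_set K \<Gamma> r)"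
    by (intro Lim_in_closed_set[OF closed_closure _ net_filter_neq_bot[OF directed transp_on[OF order_refl]]])
qed

text \<open>A point \<open>x\<close> of the induced set is fixed by some \<open>r t\<close> with
  \<open>t \<in> \<Gamma>'\<close>. Commutativity keeps every \<open>r s x\<close> inside the closed
  set \<open>r t[K]\<close>, and so does the limit.\<close>

lemma commutative_imp_limit_closed:
  assumes "has_commutative_subskeleton K \<Gamma> le r"
  shows "has_subskeleton_with_limit_closed_dense_set K \<Gamma> le r"
proof -
  obtain \<Gamma>' where \<Gamma>': "subskeleton_index \<Gamma> le \<Gamma>'" and comm: "commuting_family K \<Gamma>' r"
    using assms by (auto simp: has_commutative_subskeleton_def)
  have sub: "\<Gamma>' \<subseteq> \<Gamma>"
    using \<Gamma>' by (auto simp: subskeleton_index_def)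
  have lim: "\<exists>y\<in>induced_set K \<Gamma> r. ((\<lambda>s. r s x) \<longlongrightarrow> y) (net_filter \<Lambda> le)"
    if \<Lambda>: "\<Lambda> \<subseteq> \<Gamma>'" "up_directed \<Lambda> le" and x: "x \<in> induced_set K \<Gamma> r" for \<Lambda> x
  proof -
    have \<Lambda>\<Gamma>: "\<Lambda> \<subseteq> \<Gamma>" using \<Lambda> sub by blast
    obtain t where t: "t \<in> \<Gamma>'" "x \<in> r t ` K"
      using x unfolding induced_set_subskeleton[OF \<Gamma>', symmetric] by (auto simp: induced_set_def)
    have tG: "t \<in> \<Gamma>" using t sub by blast
    have xK: "x \<in> K" and rtx: "r t x = x"
      using t(2) r_image_iff[OF tG] by auto
    have "r s x \<in> r t ` K" if s: "s \<in> \<Lambda>" for s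
    proof -
      have "r s x = r t (r s x)"
        using comm s t(1) xK \<Lambda>(1) rtx unfolding commuting_family_def by (metis subsetD)
      then show ?thesis
        using r_in_K s \<Lambda>\<Gamma> xK by blast
    qed
    then have "\<forall>\<^sub>F s in net_filter \<Lambda> le. r s x \<in> r t ` K"
      unfolding eventually_net_filter[OF \<Lambda>(2) transp_on[OF \<Lambda>\<Gamma>]]
      using \<Lambda>(2) by (auto simp: up_directed_def)
    then have "directed_limit \<Lambda> x \<in> r t ` K"
      using tendsto_directed_limit[OF \<Lambda>\<Gamma> \<Lambda>(2) xK]
        net_filter_neq_bot[OF \<Lambda>(2) transp_on[OF \<Lambda>\<Gamma>]]
      by (intro Lim_in_closed_set[OF r_image_closed[OF tG]])
    then have "directed_limit \<Lambda> x \<in> induced_set K \<Gamma> r"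
      using tG by (auto simp: induced_set_def)
    then show ?thesis
      using tendsto_directed_limit[OF \<Lambda>\<Gamma> \<Lambda>(2) xK] by blast
  qed
  then show ?thesis
    unfolding has_subskeleton_with_limit_closed_dense_set_def
    using \<Gamma>' induced_set_dense by (intro exI[of _ \<Gamma>'] exI[of _ "induced_set K \<Gamma> r"]) auto
qed

text \<open>The commutative subskeleton consists of the \<open>r\<^sub>s\<close> that act on \<open>K \<subseteq> \<real>\<^sup>H\<close> by
  restriction to a subset of the coordinates.\<close>

lemma point_countable_imp_commutative:
  fixes H :: "('a \<Rightarrow> real) set"
  assumes cont: "\<And>h. h \<in> H \<Longrightarrow> continuous_on K h"
    and sep: "\<And>x y. x \<in> K \<Longrightarrow> y \<in> K \<Longrightarrow> x \<noteq> y \<Longrightarrow> \<exists>h\<in>H. h x \<noteq> h y"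
    and pc: "\<And>x. x \<in> induced_set K \<Gamma> r \<Longrightarrow> countable {h\<in>H. h x \<noteq> 0}"
  shows "has_commutative_subskeleton K \<Gamma> le r"
proof -
  define \<Gamma>' where "\<Gamma>' = {s\<in>\<Gamma>. \<forall>h\<in>H. (\<forall>x\<in>K. h (r s x) = h x) \<or> (\<forall>x\<in>K. h (r s x) = 0)}"
  have hlim: "(\<lambda>n. h (r (s n) x)) \<longlonglongrightarrow> h (r u x)"
    if "increasing_seq \<Gamma> le s" "is_supremum \<Gamma> le (range s) u" "h \<in> H" "x \<in> K" for s u h x
    using that(1,4) r_in_K is_supremumD(1)[OF that(2)]
    by (intro continuous_on_tendsto_compose[OF cont[OF that(3)] r_seq_limit[OF that(1,2,4)]])
       (auto simp: increasing_seq_def intro!: always_eventually)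
  have cofinal: "\<exists>s\<in>\<Gamma>'. le s\<^sub>0 s" if s\<^sub>0: "s\<^sub>0 \<in> \<Gamma>" for s\<^sub>0
  proof -
    \<comment> \<open>The coordinates that do not vanish on \<open>r s[K]\<close>. There are
      countably many, since each is nonzero at some point of a countable dense subset and
      \<open>H\<close> is point-countable.\<close>
    define J where "J s = {h\<in>H. \<exists>x\<in>K. h (r s x) \<noteq> 0}" for s
    have "countable (J s)" if s: "s \<in> \<Gamma>" for s
    proof -
      obtain C where C: "countable C" "C \<subseteq> r s ` K" "r s ` K \<subseteq> closure C"
        by (rule second_countable_dense_subset[OF r_image_second_countable[OF s] order_refl])
      have CK: "C \<subseteq> K" using C(2) r_image_subset s by blast
      have "J s \<subseteq> (\<Union>c\<in>C. {h\<in>H. h c \<noteq> 0})"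
      proof
        fix h assume "h \<in> J s"
        then obtain x where h: "h \<in> H" and x: "x \<in> K" "h (r s x) \<noteq> 0"
          by (auto simp: J_def)
        have "\<exists>c\<in>C. h c \<noteq> 0"
        proof (rule ccontr)
          assume neg: "\<not> ?thesis"
          have "h (r s x) = 0"
          proof (rule eq_on_closure[where g = "\<lambda>_. 0", OF closed_K cont[OF h] continuous_on_const CK])
            show "r s x \<in> closure C"
              using C(3) x(1) by blast
          qed (use neg in blast)
          with x(2) show False by simp
        qed
        with h show "h \<in> (\<Union>c\<in>C. {h\<in>H. h c \<noteq> 0})" by blast
      qed
      moreover have "countable (\<Union>c\<in>C. {h\<in>H. h c \<noteq> 0})"
        using C(1,2) s pc by (intro countable_UN) (auto simp: induced_set_def)
      ultimately show ?thesis by (rule countable_subset)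
    qed
    then have "\<exists>t\<in>\<Gamma>. le s t \<and> (\<forall>h\<in>J s. \<forall>x\<in>K. h (r t x) = h x)" if s: "s \<in> \<Gamma>" for s
    proof -
      have "\<forall>h\<in>J s. \<exists>p\<in>\<Gamma>. \<forall>x\<in>K. h (r p x) = h x"
        using factors_through_r cont by (auto simp: J_def)
      then obtain p where p: "\<And>h. h \<in> J s \<Longrightarrow> p h \<in> \<Gamma>" "\<And>h. h \<in> J s \<Longrightarrow> \<forall>x\<in>K. h (r (p h) x) = h x"
        by metis
      obtain t where t: "t \<in> \<Gamma>" "le s t" "\<And>q. q \<in> p ` J s \<Longrightarrow> le q t"
        by (rule countable_upper_bound[of "p ` J s" s]) (use s p \<open>s \<in> \<Gamma> \<Longrightarrow> countable (J s)\<close> in auto)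
      then have "\<forall>x\<in>K. h (r t x) = h x" if "h \<in> J s" for h
        using comp_r_mono[OF p(1)[OF that] t(1) t(3) p(2)[OF that]] that by blast
      with t show ?thesis by blast
    qed
    then obtain s u where s: "s 0 = s\<^sub>0" "increasing_seq \<Gamma> le s" "is_supremum \<Gamma> le (range s) u"
        "\<And>n. \<forall>h\<in>J (s n). \<forall>x\<in>K. h (r (s (Suc n)) x) = h x"
      by (rule increasing_sequence_from[OF s\<^sub>0]) blast+
    note u = is_supremumD[OF s(3)]
    have sG: "s n \<in> \<Gamma>" for n
      using s(2) by (simp add: increasing_seq_def)
    \<comment> \<open>A coordinate in some \<open>J (s n)\<close> factors through the next
      retraction, hence through \<open>r u\<close>; any other one vanishes on all
      \<open>r (s n)[K]\<close> and, in the limit, on \<open>r u[K]\<close>.\<close>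
    have "(\<forall>x\<in>K. h (r u x) = h x) \<or> (\<forall>x\<in>K. h (r u x) = 0)" if h: "h \<in> H" for h
    proof (cases "\<exists>n. h \<in> J (s n)")
      case True
      then obtain n where "\<forall>x\<in>K. h (r (s (Suc n)) x) = h x"
        using s(4) by blast
      then show ?thesis
        using comp_r_mono[OF sG u(1) u(2)] by blast
    next
      case False
      have "h (r u x) = 0" if x: "x \<in> K" for x
      proof -
        have "(\<lambda>n. h (r (s n) x)) = (\<lambda>n. 0)"
          using False h x by (auto simp: J_def)
        with hlim[OF s(2,3) h x] show ?thesis
          using LIMSEQ_unique tendsto_const by metis
      qed
      then show ?thesis by blast
    qed
    then have "u \<in> \<Gamma>'"
      using u(1) by (simp add: \<Gamma>'_def)
    with u(2)[of 0] s(1) show ?thesis by blast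
  qed
  have closed: "u \<in> \<Gamma>'" if s: "increasing_seq \<Gamma>' le s" and u: "is_supremum \<Gamma> le (range s) u" for s u
  proof -
    have inc: "increasing_seq \<Gamma> le s"
      using s by (auto simp: increasing_seq_def \<Gamma>'_def)
    have uG: "u \<in> \<Gamma>" "\<And>n. le (s n) u" using is_supremumD[OF u] by auto
    have sG: "s n \<in> \<Gamma>'" "s n \<in> \<Gamma>" for n
      using s by (auto simp: increasing_seq_def \<Gamma>'_def)
    have "(\<forall>x\<in>K. h (r u x) = h x) \<or> (\<forall>x\<in>K. h (r u x) = 0)" if h: "h \<in> H" for h
    proof (cases "\<exists>n. \<forall>x\<in>K. h (r (s n) x) = h x")
      case True
      then show ?thesis
        using comp_r_mono[OF sG(2) uG(1) uG(2)] by blast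
    next
      case False
      then have "(\<lambda>n. h (r (s n) x)) = (\<lambda>n. 0)" if "x \<in> K" for x
        using sG(1) h that unfolding \<Gamma>'_def by fastforce
      then have "h (r u x) = 0" if "x \<in> K" for x
        using hlim[OF inc u h that] LIMSEQ_unique tendsto_const that by metis
      then show ?thesis by blast
    qed
    with uG show ?thesis by (simp add: \<Gamma>'_def)
  qed
  have "commuting_family K \<Gamma>' r"
    unfolding commuting_family_def
  proof (intro ballI)
    fix s t x assume st: "s \<in> \<Gamma>'" "t \<in> \<Gamma>'" and x: "x \<in> K"
    have stG: "s \<in> \<Gamma>" "t \<in> \<Gamma>" using st by (auto simp: \<Gamma>'_def)
    have K: "r s x \<in> K" "r t x \<in> K" "r s (r t x) \<in> K" "r t (r s x) \<in> K"
      using stG x r_in_K by auto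
    \<comment> \<open>Both sides equal \<open>h x\<close> if \<open>r s\<close> and
      \<open>r t\<close> both preserve \<open>h\<close>, and 0 otherwise.\<close>
    have "h (r s (r t x)) = h (r t (r s x))" if "h \<in> H" for h
      using st that x K(1,2) unfolding \<Gamma>'_def by (smt (verit, best) mem_Collect_eq)
    then show "r s (r t x) = r t (r s x)"
      using sep[OF K(3,4)] by blast
  qed
  moreover have "subskeleton_index \<Gamma> le \<Gamma>'"
    unfolding subskeleton_index_def using cofinal closed \<Gamma>'_def by blast
  ultimately show ?thesis
    by (auto simp: has_commutative_subskeleton_def)
qed

text \<open>Indices of the two skeletons are interleaved so that the suprema satisfy
  \<open>r u \<circ> q v = r u\<close> and \<open>q v[K] \<subseteq> r u[K]\<close>. The second
  relation gives \<open>r u \<circ> q v = q v\<close>, and the two retractions coincide.\<close>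

lemma common_retractions_cofinal:
  fixes \<Delta> :: "'j set" and q :: "'j \<Rightarrow> 'a \<Rightarrow> 'a"
  assumes q: "retractional_skeleton K \<Delta> le' q" and D: "induced_set K \<Delta> q \<subseteq> induced_set K \<Gamma> r"
    and s\<^sub>0: "s\<^sub>0 \<in> \<Gamma>"
  shows "\<exists>s\<in>\<Gamma>. le s\<^sub>0 s \<and> (\<exists>i\<in>\<Delta>. \<forall>x\<in>K. r s x = q i x)"
proof -
  interpret q: compact_skeleton K \<Delta> le' q
    using compact_K q by unfold_locales
  \<comment> \<open>Countably many functions separate the points of the metrizable
    \<open>r s[K]\<close>; each of them composed with \<open>r s\<close> factors through some
    \<open>q\<close>, and one \<open>q j\<close> serves all.\<close>
  have step1: "\<exists>j\<in>\<Delta>. le' i j \<and> (\<forall>x\<in>K. r s (q j x) = r s x)" if s: "s \<in> \<Gamma>" and i: "i \<in> \<Delta>" for s i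
  proof -
    have contr: "continuous_on (r s ` K) f" if "f \<in> {f. continuous_on K f}" for f :: "'a \<Rightarrow> real"
      using that continuous_on_subset[OF _ r_image_subset[OF s]] by blast
    have sepr: "\<exists>f\<in>{f. continuous_on K f}. (f x :: real) \<noteq> f y"
      if xy: "x \<in> r s ` K" "y \<in> r s ` K" "x \<noteq> y" for x y
    proof -
      have K: "x \<in> K" "y \<in> K"
        using xy r_image_subset[OF s] by auto
      obtain f :: "'a \<Rightarrow> real" where "continuous_on K f" "f x \<noteq> f y"
        by (rule compact_Urysohn_separate[OF compact_K K xy(3)])
      then show ?thesis by blast
    qed
    obtain F :: "('a \<Rightarrow> real) set" where F: "countable F" "F \<subseteq> {f. continuous_on K f}"
        "\<And>x y. x \<in> r s ` K \<Longrightarrow> y \<in> r s ` K \<Longrightarrow> x \<noteq> y \<Longrightarrow> \<exists>f\<in>F. f x \<noteq> f y"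
      by (rule countable_separating_subset[OF r_image_second_countable[OF s] contr sepr]) blast+
    have "\<forall>f\<in>F. \<exists>j\<in>\<Delta>. \<forall>x\<in>K. f (r s (q j x)) = f (r s x)"
      using F(2) comp_r_continuous[OF _ s] by (intro ballI q.factors_through_r) auto
    then obtain p where p: "\<And>f. f \<in> F \<Longrightarrow> p f \<in> \<Delta>" "\<And>f. f \<in> F \<Longrightarrow> \<forall>x\<in>K. f (r s (q (p f) x)) = f (r s x)"
      by metis
    obtain j where j: "j \<in> \<Delta>" "le' i j" "\<And>k. k \<in> p ` F \<Longrightarrow> le' k j"
      by (rule q.countable_upper_bound[of "p ` F" i]) (use F(1) i p in auto)
    have "r s (q j x) = r s x" if x: "x \<in> K" for x
    proof (rule ccontr)
      assume "r s (q j x) \<noteq> r s x"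
      then obtain f where f: "f \<in> F" "f (r s (q j x)) \<noteq> f (r s x)"
        using F(3) q.r_in_K[OF j(1) x] x by blast
      moreover have "\<forall>x\<in>K. f (r s (q j x)) = f (r s x)"
        using q.comp_r_mono[OF p(1) j(1) j(3), of f "\<lambda>x. f (r s x)"] p(2) f(1) by blast
      ultimately show False using x by blast
    qed
    with j show ?thesis by blast
  qed
  \<comment> \<open>A countable dense subset of \<open>q j[K]\<close> lies in the induced set of
    \<open>r\<close>, hence in one closed range \<open>r t[K]\<close>.\<close>
  have step2: "\<exists>t\<in>\<Gamma>. le s t \<and> q j ` K \<subseteq> r t ` K" if s: "s \<in> \<Gamma>" and j: "j \<in> \<Delta>" for s j
  proof -
    obtain C where C: "countable C" "C \<subseteq> q j ` K" "q j ` K \<subseteq> closure C"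
      by (rule second_countable_dense_subset[OF q.r_image_second_countable[OF j] order_refl])
    have CD: "C \<subseteq> induced_set K \<Gamma> r"
    proof (rule order_trans[OF _ D])
      show "C \<subseteq> induced_set K \<Delta> q"
        unfolding induced_set_def by (rule subset_trans[OF C(2)], rule UN_upper[OF j])
    qed
    obtain t where t: "t \<in> \<Gamma>" "le s t" "C \<subseteq> r t ` K"
      by (rule induced_set_countable_subset[OF C(1) CD s])
    have "closure C \<subseteq> r t ` K"
      using t r_image_closed by (intro closure_minimal)
    with C(3) t show ?thesis by blast
  qed
  define R where "R = (\<lambda>(s, i) (t, j). le s t \<and> le' i j \<and> (\<forall>x\<in>K. r s (q j x) = r s x) \<and> q j ` K \<subseteq> r t ` K)"
  have step: "\<exists>p'. p' \<in> \<Gamma> \<times> \<Delta> \<and> R p p'" if "p \<in> \<Gamma> \<times> \<Delta>" for p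
  proof -
    obtain s i where p: "p = (s, i)" "s \<in> \<Gamma>" "i \<in> \<Delta>"
      using \<open>p \<in> \<Gamma> \<times> \<Delta>\<close> by auto
    obtain j where j: "j \<in> \<Delta>" "le' i j" "\<forall>x\<in>K. r s (q j x) = r s x"
      using step1 p by blast
    obtain t where t: "t \<in> \<Gamma>" "le s t" "q j ` K \<subseteq> r t ` K"
      using step2 p j by blast
    with p j show ?thesis
      by (intro exI[of _ "(t, j)"]) (simp add: R_def)
  qed
  obtain i\<^sub>0 where i\<^sub>0: "i\<^sub>0 \<in> \<Delta>"
    using q.directed by (auto simp: up_directed_def)
  have "\<exists>p. \<forall>n. (p n \<in> \<Gamma> \<times> \<Delta> \<and> (n = 0 \<longrightarrow> p n = (s\<^sub>0, i\<^sub>0))) \<and> R (p n) (p (Suc n))"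
    using s\<^sub>0 i\<^sub>0 step by (intro dependent_nat_choice) auto
  then obtain p where p: "\<And>n. p n \<in> \<Gamma> \<times> \<Delta>" "p 0 = (s\<^sub>0, i\<^sub>0)" "\<And>n. R (p n) (p (Suc n))"
    by blast
  define s where "s n = fst (p n)" for n
  define i where "i n = snd (p n)" for n
  have sG: "s n \<in> \<Gamma>" and iG: "i n \<in> \<Delta>" for n
    using p(1)[of n] by (auto simp: s_def i_def)
  have Rn: "le (s n) (s (Suc n))" "le' (i n) (i (Suc n))"
      "\<And>x. x \<in> K \<Longrightarrow> r (s n) (q (i (Suc n)) x) = r (s n) x" "q (i (Suc n)) ` K \<subseteq> r (s (Suc n)) ` K" for n
    using p(3)[of n] by (auto simp: R_def s_def i_def split_beta)
  have inc: "increasing_seq \<Gamma> le s" "increasing_seq \<Delta> le' i"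
    using Rn sG iG by (auto simp: increasing_seq_def)
  obtain u where u: "is_supremum \<Gamma> le (range s) u"
    using sup_exists[OF inc(1)] by blast
  obtain v where v: "is_supremum \<Delta> le' (range i) v"
    using q.sup_exists[OF inc(2)] by blast
  note uG = is_supremumD[OF u] and vD = q.is_supremumD[OF v]
  have "r u x = q v x" if x: "x \<in> K" for x
  proof -
    have qx: "q v x \<in> K" using x vD q.r_in_K by blast
    have "r (s n) (q v x) = r (s n) x" for n
      using Rn(3)[OF x, of n] Rn(3)[OF qx, of n] q.r_absorb(2)[OF iG vD(1) vD(2) x, of "Suc n"]
      by simp
    then have "r u (q v x) = r u x"
      using r_seq_limit[OF inc(1) u qx] r_seq_limit[OF inc(1) u x] LIMSEQ_unique by auto
    moreover have "q (i (Suc n)) x \<in> r u ` K" for n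
      using Rn(4)[of n] r_image_mono[OF sG uG, of "Suc n"] x by blast
    then have "q v x \<in> r u ` K"
      using LIMSEQ_Suc[OF q.r_seq_limit[OF inc(2) v x]] r_image_closed[OF uG(1)]
      by (metis closed_sequentially)
    then have "r u (q v x) = q v x"
      using r_image_iff uG(1) by blast
    ultimately show ?thesis by simp
  qed
  moreover have "le s\<^sub>0 u"
    using uG(2)[of 0] p(2) by (simp add: s_def)
  ultimately show ?thesis
    using uG(1) vD(1) by blast
qed

text \<open>The retractions shared with the commutative skeleton need not be closed under suprema, but
  their bicommutant in the family is.\<close>

lemma induced_by_commutative_imp_subskeleton:
  fixes I :: "'j itself"
  assumes "induced_by_commutative_skeleton I K (induced_set K \<Gamma> r)"
  shows "has_commutative_subskeleton K \<Gamma> le r"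
proof -
  obtain \<Delta> :: "'j set" and le' q where q: "retractional_skeleton K \<Delta> le' q"
      "commuting_family K \<Delta> q" "induced_set K \<Delta> q = induced_set K \<Gamma> r"
    using assms by (auto simp: induced_by_commutative_skeleton_def)
  define comm where "comm s t \<longleftrightarrow> (\<forall>x\<in>K. r s (r t x) = r t (r s x))" for s t
  define \<Gamma>\<^sub>0 where "\<Gamma>\<^sub>0 = {s\<in>\<Gamma>. \<exists>i\<in>\<Delta>. \<forall>x\<in>K. r s x = q i x}"
  \<comment> \<open>\<open>C\<close> is the commutant of \<open>\<Gamma>\<^sub>0\<close> in the
    family and \<open>\<Gamma>'\<close> the commutant of \<open>C\<close>. Since
    \<open>\<Gamma>\<^sub>0\<close> commutes, it lies in \<open>C\<close>, so
    \<open>\<Gamma>' \<subseteq> C\<close> and \<open>\<Gamma>'\<close> commutes.\<close>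
  define C where "C = {t\<in>\<Gamma>. \<forall>s\<in>\<Gamma>\<^sub>0. comm s t}"
  define \<Gamma>' where "\<Gamma>' = {s\<in>\<Gamma>. \<forall>t\<in>C. comm s t}"
  have sym: "comm s t \<Longrightarrow> comm t s" for s t
    by (simp add: comm_def)
  have "comm s t" if st: "s \<in> \<Gamma>\<^sub>0" "t \<in> \<Gamma>\<^sub>0" for s t
  proof -
    obtain i j where ij: "i \<in> \<Delta>" "j \<in> \<Delta>" "\<forall>x\<in>K. r s x = q i x" "\<forall>x\<in>K. r t x = q j x"
      using st by (auto simp: \<Gamma>\<^sub>0_def)
    have "r s x \<in> K" "r t x \<in> K" if "x \<in> K" for x
      using st that r_in_K by (auto simp: \<Gamma>\<^sub>0_def)
    with ij q(2) show ?thesis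
      unfolding comm_def commuting_family_def by metis
  qed
  then have "\<Gamma>\<^sub>0 \<subseteq> C"
    by (auto simp: C_def \<Gamma>\<^sub>0_def)
  then have "\<Gamma>' \<subseteq> C"
    unfolding \<Gamma>'_def C_def using sym by blast
  then have "commuting_family K \<Gamma>' r"
    unfolding commuting_family_def \<Gamma>'_def using comm_def by blast
  moreover have "\<Gamma>\<^sub>0 \<subseteq> \<Gamma>'"
    using sym unfolding \<Gamma>'_def C_def \<Gamma>\<^sub>0_def by blast
  then have "\<exists>s\<in>\<Gamma>'. le s\<^sub>0 s" if "s\<^sub>0 \<in> \<Gamma>" for s\<^sub>0
    using common_retractions_cofinal[OF q(1) _ that] q(3) unfolding \<Gamma>\<^sub>0_def by blast
  moreover have "u \<in> \<Gamma>'" if s: "increasing_seq \<Gamma>' le s" and u: "is_supremum \<Gamma> le (range s) u" for s u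
  proof -
    have inc: "increasing_seq \<Gamma> le s" and s': "\<And>n. s n \<in> \<Gamma>'" "\<And>n. s n \<in> \<Gamma>"
      using s by (auto simp: increasing_seq_def \<Gamma>'_def)
    note uG = is_supremumD(1)[OF u]
    have "r u (r t x) = r t (r u x)" if t: "t \<in> C" and x: "x \<in> K" for t x
    proof -
      have tG: "t \<in> \<Gamma>" using t by (simp add: C_def)
      \<comment> \<open>Commuting with a fixed continuous \<open>r t\<close> survives pointwise
        limits, so the commutant is closed under suprema.\<close>
      have "(\<lambda>n. r t (r (s n) x)) \<longlonglongrightarrow> r t (r u x)"
        using r_in_K s'(2) uG x
        by (intro continuous_on_tendsto_compose[OF r_continuous[OF tG] r_seq_limit[OF inc u x]]) auto
      moreover have "r t (r (s n) x) = r (s n) (r t x)" for n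
        using s'(1)[of n] t x by (auto simp: \<Gamma>'_def comm_def)
      ultimately show ?thesis
        using r_seq_limit[OF inc u r_in_K[OF tG x]] LIMSEQ_unique by auto
    qed
    with uG show ?thesis
      by (simp add: \<Gamma>'_def comm_def)
  qed
  moreover have "\<Gamma>' \<subseteq> \<Gamma>"
    by (auto simp: \<Gamma>'_def)
  ultimately show ?thesis
    unfolding has_commutative_subskeleton_def subskeleton_index_def by blast
qed

end

section \<open>Closures under a binary operation and initial segments\<close>

unbundle cardinal_syntax

text \<open>With a choice of upper bounds as \<open>f\<close>, this produces directed index sets of
  controlled cardinality.\<close>

inductive_set binary_closure :: "('i \<Rightarrow> 'i \<Rightarrow> 'i) \<Rightarrow> 'i set \<Rightarrow> 'i set"
  for f :: "'i \<Rightarrow> 'i \<Rightarrow> 'i" and S :: "'i set" where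
    generator: "s \<in> S \<Longrightarrow> s \<in> binary_closure f S"
  | closed: "s \<in> binary_closure f S \<Longrightarrow> t \<in> binary_closure f S \<Longrightarrow> f s t \<in> binary_closure f S"

lemma binary_closure_minimal:
  assumes "S \<subseteq> T" "\<And>s t. s \<in> T \<Longrightarrow> t \<in> T \<Longrightarrow> f s t \<in> T"
  shows "binary_closure f S \<subseteq> T"
proof
  fix s assume "s \<in> binary_closure f S"
  then show "s \<in> T"
    by induction (use assms in auto)
qed

lemma binary_closure_mono: "S \<subseteq> T \<Longrightarrow> binary_closure f S \<subseteq> binary_closure f T"
  by (intro binary_closure_minimal) (auto intro: binary_closure.intros)

text \<open>These stages exhaust the closure after countably many steps, which makes its cardinality
  accessible.\<close>

primrec binary_closure_stage :: "('i \<Rightarrow> 'i \<Rightarrow> 'i) \<Rightarrow> 'i set \<Rightarrow> nat \<Rightarrow> 'i set" where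
  "binary_closure_stage f S 0 = S"
| "binary_closure_stage f S (Suc n) = binary_closure_stage f S n \<union>
     case_prod f ` (binary_closure_stage f S n \<times> binary_closure_stage f S n)"

lemma binary_closure_stage_mono:
  "m \<le> n \<Longrightarrow> binary_closure_stage f S m \<subseteq> binary_closure_stage f S n"
  by (rule lift_Suc_mono_le[of "binary_closure_stage f S"]) auto

lemma binary_closure_subset_stages: "binary_closure f S \<subseteq> (\<Union>n. binary_closure_stage f S n)"
proof (rule binary_closure_minimal)
  show "S \<subseteq> (\<Union>n. binary_closure_stage f S n)"
    using binary_closure_stage.simps(1)[of f S] by blast
  fix s t assume "s \<in> (\<Union>n. binary_closure_stage f S n)" "t \<in> (\<Union>n. binary_closure_stage f S n)"
  then obtain m n where mn: "s \<in> binary_closure_stage f S m" "t \<in> binary_closure_stage f S n"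
    by blast
  have "s \<in> binary_closure_stage f S (max m n)" "t \<in> binary_closure_stage f S (max m n)"
    using mn binary_closure_stage_mono[of m "max m n" f S] binary_closure_stage_mono[of n "max m n" f S]
    by auto
  then have "f s t \<in> binary_closure_stage f S (Suc (max m n))"
    by force
  then show "f s t \<in> (\<Union>n. binary_closure_stage f S n)" by blast
qed

lemma countable_binary_closure:
  assumes "countable S"
  shows "countable (binary_closure f S)"
proof (rule countable_subset[OF binary_closure_subset_stages countable_UN])
  show "countable (binary_closure_stage f S n)" for n
    by (induction n) (use assms in auto)
qed simp

section \<open>Cardinality bounds for closures\<close>

lemma finite_card_of_ordLess: "finite A \<Longrightarrow> infinite B \<Longrightarrow> |A| <o |B|"
  by (rule finite_ordLess_infinite) (simp_all add: Field_card_of card_of_well_order_on)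

lemma card_of_Un_bound:
  "infinite X \<Longrightarrow> |A| \<le>o |X| \<Longrightarrow> |B| \<le>o |X| \<Longrightarrow> |A \<union> B| \<le>o |X|"
  by (rule card_of_Un_ordLeq_infinite_Field) (simp_all add: Field_card_of card_of_card_order_on)

text \<open>An infinite \<open>X\<close> absorbs its square and countable unions, so first each
  stage and then their union stays within its cardinality.\<close>

lemma card_of_binary_closure:
  assumes X: "infinite X" and S: "|S| \<le>o |X|"
  shows "|binary_closure f S| \<le>o |X|"
proof -
  have "|binary_closure_stage f S n| \<le>o |X|" for n
  proof (induction n)
    case (Suc n)
    have "|binary_closure_stage f S n \<times> binary_closure_stage f S n| \<le>o |X|"
      using card_of_Times_mono1[OF Suc, of "binary_closure_stage f S n"]
        card_of_Times_mono2[OF Suc, of X] card_of_Times_same_infinite[OF X]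
      by (meson ordIso_imp_ordLeq ordLeq_transitive)
    then have "|case_prod f ` (binary_closure_stage f S n \<times> binary_closure_stage f S n)| \<le>o |X|"
      by (rule ordLeq_transitive[OF card_of_image])
    with Suc show ?case
      using card_of_Un_bound[OF X] by simp
  qed (use S in simp)
  then have "|\<Union>n. binary_closure_stage f S n| \<le>o |X|"
    using X by (intro card_of_UNION_ordLeq_infinite) (auto simp: infinite_iff_card_of_nat)
  then show ?thesis
    by (rule ordLeq_transitive[OF card_of_mono1[OF binary_closure_subset_stages]])
qed

text \<open>If \<open>S\<close> is countable, so is the closure, while \<open>Y\<close> is not; if
  \<open>S\<close> is uncountable, the closure is no larger than \<open>S\<close>. The finite
  \<open>B\<close> leaves room for additional generators.\<close>

lemma card_of_binary_closure_ordLess: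
  assumes Y: "uncountable Y" and S: "|S| <o |Y|" and B: "finite B"
  shows "|binary_closure f (B \<union> S)| <o |Y|"
proof (cases "countable S")
  case True
  then have c: "countable (binary_closure f (B \<union> S))"
    using B by (intro countable_binary_closure) (simp add: countable_finite)
  show ?thesis
  proof (rule ccontr)
    assume "\<not> ?thesis"
    then have "|Y| \<le>o |binary_closure f (B \<union> S)|"
      by (simp add: not_ordLess_iff_ordLeq[OF card_of_Well_order card_of_Well_order])
    then obtain g where "inj_on g Y" "g ` Y \<subseteq> binary_closure f (B \<union> S)"
      using card_of_ordLeq[THEN iffD2] by blast
    then show False
      using Y c by (meson countable_subset countable_image_inj_on)
  qed
next
  case False
  then have inf: "infinite S"
    using countable_finite by blast
  have "|B \<union> S| \<le>o |S|"
    by (rule card_of_Un_bound[OF inf ordLess_imp_ordLeq[OF finite_card_of_ordLess[OF B inf]] card_of_mono1[OF order_refl]])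
  then have "|binary_closure f (B \<union> S)| \<le>o |S|"
    by (rule card_of_binary_closure[OF inf])
  then show ?thesis
    using S by (rule ordLeq_ordLess_trans)
qed

text \<open>The cardinal \<open>|Y|\<close> is itself a well-order on \<open>Y\<close> of least
  possible type, so its proper initial segments are smaller; \<open>lt\<close> is its strict
  part.\<close>

lemma wellorder_with_small_segments:
  fixes Y :: "'i set"
  obtains lt :: "'i \<Rightarrow> 'i \<Rightarrow> bool" where "wfP lt" "transp lt"
    "\<And>a b. a \<in> Y \<Longrightarrow> b \<in> Y \<Longrightarrow> lt a b \<or> a = b \<or> lt b a"
    "\<And>a. a \<in> Y \<Longrightarrow> |{b\<in>Y. lt b a}| <o |Y|"
proof -
  define lt where "lt a b \<longleftrightarrow> (a, b) \<in> |Y| \<and> a \<noteq> b" for a b :: 'i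
  have wo: "well_order_on Y |Y|"
    by (rule card_of_well_order_on)
  have "{(a, b). lt a b} = |Y| - Id"
    by (auto simp: lt_def)
  then have "wfP lt"
    using wo by (simp add: well_order_on_def wfp_def)
  moreover have "trans |Y|" "antisym |Y|" "total_on Y |Y|"
    using wo by (simp_all add: well_order_on_def linear_order_on_def partial_order_on_def preorder_on_def)
  then have "transp lt" and total: "\<And>a b. a \<in> Y \<Longrightarrow> b \<in> Y \<Longrightarrow> lt a b \<or> a = b \<or> lt b a"
    unfolding lt_def transp_def trans_def antisym_def total_on_def by blast+
  moreover have "|{b\<in>Y. lt b a}| <o |Y|" if "a \<in> Y" for a
  proof -
    have "{b\<in>Y. lt b a} \<subseteq> underS |Y| a"
      by (auto simp: underS_def lt_def)
    moreover have "|underS |Y| a| <o |Y|"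
      using that by (intro card_of_underS) (simp_all add: card_of_card_order_on Field_card_of)
    ultimately show ?thesis
      using card_of_mono1 ordLeq_ordLess_trans by blast
  qed
  ultimately show ?thesis
    by (intro that[of lt])
qed

text \<open>Cut at the least point with uncountably many elements of \<open>J\<close> below it, or
  take all of \<open>Y\<close> if there is no such point.\<close>

lemma uncountable_initial_segment:
  assumes "wfP lt" "transp lt" and "uncountable (J \<inter> Y)"
  obtains L where "L \<subseteq> Y" "\<And>a b. a \<in> L \<Longrightarrow> b \<in> Y \<Longrightarrow> lt b a \<Longrightarrow> b \<in> L" "uncountable (J \<inter> L)"
    "\<And>c. c \<in> L \<Longrightarrow> countable (J \<inter> {b\<in>Y. lt b c})"
proof (cases "\<exists>a\<in>Y. uncountable (J \<inter> {b\<in>Y. lt b a})")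
  case True
  let ?T = "{a\<in>Y. uncountable (J \<inter> {b\<in>Y. lt b a})}"
  obtain a\<^sub>0 where "a\<^sub>0 \<in> ?T"
    using True by blast
  then obtain a where a: "a \<in> ?T" "\<And>c. lt c a \<Longrightarrow> c \<notin> ?T"
    using assms(1) unfolding wfp_eq_minimal by meson
  show ?thesis
  proof (rule that[of "{b\<in>Y. lt b a}"])
    show "uncountable (J \<inter> {b\<in>Y. lt b a})"
      using a(1) by simp
    show "countable (J \<inter> {b\<in>Y. lt b c})" if "c \<in> {b\<in>Y. lt b a}" for c
      using a(2)[of c] that by simp
  qed (use assms(2) in \<open>auto dest: transpD\<close>)
next
  case False
  then show ?thesis
    using assms(3) by (intro that[of Y]) auto
qed

section \<open>Point-countable separating families\<close>

context compact_skeleton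
begin

text \<open>The base case of the induction. Countably many functions of \<open>A\<close> separate
  the points of each metrizable \<open>r s[K]\<close>; composed with \<open>r s\<close> they stay in
  \<open>A\<close>, and over all \<open>s \<in> \<Lambda>\<close> they determine the limit.\<close>

lemma countable_separating_family:
  assumes \<Lambda>: "\<Lambda> \<subseteq> \<Gamma>" "up_directed \<Lambda> le" "countable \<Lambda>"
    and cont: "\<And>f. f \<in> A \<Longrightarrow> continuous_on K f"
    and sep: "\<And>x y. x \<in> K \<Longrightarrow> y \<in> K \<Longrightarrow> x \<noteq> y \<Longrightarrow> \<exists>f\<in>A. f x \<noteq> (f y :: real)"
    and inv: "\<And>f s. f \<in> A \<Longrightarrow> s \<in> \<Gamma> \<Longrightarrow> (\<lambda>x\<in>K. f (r s x)) \<in> A"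
  obtains H where "H \<subseteq> A" "countable H"
    "\<And>h x. h \<in> H \<Longrightarrow> x \<in> K \<Longrightarrow> h (directed_limit \<Lambda> x) = h x"
    "\<And>x y. x \<in> K \<Longrightarrow> y \<in> K \<Longrightarrow> directed_limit \<Lambda> x \<noteq> directed_limit \<Lambda> y \<Longrightarrow> \<exists>h\<in>H. h x \<noteq> h y"
proof -
  have "\<exists>F. countable F \<and> F \<subseteq> A \<and> (\<forall>x\<in>r s ` K. \<forall>y\<in>r s ` K. x \<noteq> y \<longrightarrow> (\<exists>f\<in>F. f x \<noteq> f y))"
    if s: "s \<in> \<Lambda>" for s
  proof -
    have sG: "s \<in> \<Gamma>" using s \<Lambda>(1) by blast
    have c: "continuous_on (r s ` K) f" if "f \<in> A" for f
      using continuous_on_subset[OF cont[OF that] r_image_subset[OF sG]] .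
    have sp: "\<exists>f\<in>A. f x \<noteq> f y" if "x \<in> r s ` K" "y \<in> r s ` K" "x \<noteq> y" for x y
      using sep[of x y] that r_image_subset[OF sG] by auto
    obtain F where "countable F" "F \<subseteq> A"
        "\<And>x y. x \<in> r s ` K \<Longrightarrow> y \<in> r s ` K \<Longrightarrow> x \<noteq> y \<Longrightarrow> \<exists>f\<in>F. f x \<noteq> f y"
      by (rule countable_separating_subset[OF r_image_second_countable[OF sG] c sp]) blast+
    then show ?thesis by (intro exI[of _ F]) simp
  qed
  then obtain F where F: "\<And>s. s \<in> \<Lambda> \<Longrightarrow> countable (F s)" "\<And>s. s \<in> \<Lambda> \<Longrightarrow> F s \<subseteq> A"
      "\<And>s x y. s \<in> \<Lambda> \<Longrightarrow> x \<in> r s ` K \<Longrightarrow> y \<in> r s ` K \<Longrightarrow> x \<noteq> y \<Longrightarrow> \<exists>f\<in>F s. f x \<noteq> f y"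
    by metis
  define H where "H = (\<Union>s\<in>\<Lambda>. (\<lambda>f. \<lambda>x\<in>K. f (r s x)) ` F s)"
  show ?thesis
  proof
    show "H \<subseteq> A"
      unfolding H_def
    proof clarify
      fix s f assume "s \<in> \<Lambda>" "f \<in> F s"
      then show "(\<lambda>x\<in>K. f (r s x)) \<in> A"
        using F(2)[of s] \<Lambda>(1) by (intro inv) auto
    qed
    show "countable H"
      unfolding H_def using \<Lambda>(3) F(1) by (intro countable_UN) auto
    show "h (directed_limit \<Lambda> x) = h x" if "h \<in> H" "x \<in> K" for h x
      using that r_directed_limit[OF \<Lambda>(1,2) that(2)] directed_limit_in_K[OF \<Lambda>(1,2) that(2)]
      by (auto simp: H_def)
    fix x y assume xy: "x \<in> K" "y \<in> K" "directed_limit \<Lambda> x \<noteq> directed_limit \<Lambda> y"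
    then obtain s where s: "s \<in> \<Lambda>" "r s x \<noteq> r s y"
      using directed_limit_cong[OF \<Lambda>(1,2)] by blast
    then obtain f where "f \<in> F s" "f (r s x) \<noteq> f (r s y)"
      using F(3)[OF s(1), of "r s x" "r s y"] xy by blast
    with s(1) xy show "\<exists>h\<in>H. h x \<noteq> h y"
      unfolding H_def by (intro bexI[of _ "\<lambda>x\<in>K. f (r s x)"]) auto
  qed
qed

end

text \<open>The setting for (iii) implies (iv). \<open>ub\<close> is a fixed choice of upper bounds
  in \<open>\<Gamma>'\<close> and \<open>b\<close> a base index. \<open>A_half_diff\<close> is the
  combined use of symmetry and convexity, and \<open>A_closed\<close> is closedness in the supremum
  norm.\<close>

locale limit_closed_skeleton = compact_skeleton +
  fixes \<Gamma>' :: "'b set" and D :: "'a set" and A :: "('a \<Rightarrow> real) set" and ub :: "'b \<Rightarrow> 'b \<Rightarrow> 'b" and b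
  assumes subskeleton: "subskeleton_index \<Gamma> le \<Gamma>'"
    and D_subset: "D \<subseteq> induced_set K \<Gamma> r"
    and D_limit: "\<And>\<Lambda> x. \<Lambda> \<subseteq> \<Gamma>' \<Longrightarrow> up_directed \<Lambda> le \<Longrightarrow> x \<in> D \<Longrightarrow>
        \<exists>y\<in>D. ((\<lambda>s. r s x) \<longlongrightarrow> y) (net_filter \<Lambda> le)"
    and ub: "\<And>s t. s \<in> \<Gamma>' \<Longrightarrow> t \<in> \<Gamma>' \<Longrightarrow> ub s t \<in> \<Gamma>' \<and> le s (ub s t) \<and> le t (ub s t)"
    and b: "b \<in> \<Gamma>'"
    and A_continuous: "\<And>f. f \<in> A \<Longrightarrow> continuous_on K f"
    and A_separates: "\<And>x y. x \<in> K \<Longrightarrow> y \<in> K \<Longrightarrow> x \<noteq> y \<Longrightarrow> \<exists>f\<in>A. f x \<noteq> f y"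
    and A_invariant: "\<And>f s. f \<in> A \<Longrightarrow> s \<in> \<Gamma> \<Longrightarrow> (\<lambda>x\<in>K. f (r s x)) \<in> A"
    and A_half_diff: "\<And>f g. f \<in> A \<Longrightarrow> g \<in> A \<Longrightarrow> (\<lambda>x\<in>K. (f x - g x) / 2) \<in> A"
    and A_closed: "\<And>f. f \<in> extensional K \<Longrightarrow> continuous_on K f \<Longrightarrow> (\<And>e. e > 0 \<Longrightarrow> \<exists>g\<in>A. \<forall>x\<in>K. \<bar>g x - f x\<bar> < e) \<Longrightarrow> f \<in> A"
begin

lemma subset_\<Gamma>: "\<Gamma>' \<subseteq> \<Gamma>"
  using subskeleton by (simp add: subskeleton_index_def)

text \<open>Adjoining \<open>b\<close> makes every hull nonempty, in particular that of the empty
  set, so that hulls of subsets of \<open>\<Gamma>'\<close> are directed.\<close>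

definition join_hull :: "'b set \<Rightarrow> 'b set" where
  "join_hull S = binary_closure ub (insert b S)"

lemma join_hull_subset: "S \<subseteq> \<Lambda> \<Longrightarrow> \<Lambda> \<subseteq> \<Gamma>' \<Longrightarrow> join_hull \<Lambda> = \<Lambda> \<Longrightarrow> join_hull S \<subseteq> \<Lambda>"
  unfolding join_hull_def using binary_closure_mono[of "insert b S" "insert b \<Lambda>" ub] by blast

lemma join_hull_mono: "S \<subseteq> T \<Longrightarrow> join_hull S \<subseteq> join_hull T"
  unfolding join_hull_def by (intro binary_closure_mono) blast

lemma join_hull_superset: "S \<subseteq> join_hull S"
  unfolding join_hull_def by (auto intro: binary_closure.generator)

lemma join_hull_hull: "join_hull (join_hull S) = join_hull S"
proof
  show "join_hull (join_hull S) \<subseteq> join_hull S"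
    unfolding join_hull_def[of "join_hull S"]
    by (rule binary_closure_minimal) (auto simp: join_hull_def intro: binary_closure.intros)
qed (rule join_hull_superset)

lemma join_hull_in_\<Gamma>': "S \<subseteq> \<Gamma>' \<Longrightarrow> join_hull S \<subseteq> \<Gamma>'"
  unfolding join_hull_def using b ub by (intro binary_closure_minimal) auto

lemma join_hull_in_\<Gamma>: "S \<subseteq> \<Gamma>' \<Longrightarrow> join_hull S \<subseteq> \<Gamma>"
  using join_hull_in_\<Gamma>' subset_\<Gamma> by blast

lemma join_hull_directed:
  assumes "S \<subseteq> \<Gamma>'"
  shows "up_directed (join_hull S) le"
  unfolding up_directed_def
proof (intro conjI ballI)
  show "join_hull S \<noteq> {}"
    by (auto simp: join_hull_def intro: binary_closure.generator)
  fix s t assume st: "s \<in> join_hull S" "t \<in> join_hull S"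
  then have "ub s t \<in> join_hull S"
    by (simp add: join_hull_def binary_closure.closed)
  with ub[of s t] st join_hull_in_\<Gamma>'[OF assms] show "\<exists>u\<in>join_hull S. le s u \<and> le t u"
    by blast
qed

lemma directed_limit_in_D:
  assumes "\<Lambda> \<subseteq> \<Gamma>'" "up_directed \<Lambda> le" "x \<in> D"
  shows "directed_limit \<Lambda> x \<in> D"
proof -
  have "x \<in> K"
    using assms(3) D_subset r_image_subset by (auto simp: induced_set_def)
  then show ?thesis
    using D_limit[OF assms] directed_limit_unique[OF _ assms(2)] assms(1) subset_\<Gamma> by blast
qed

text \<open>The function is a uniform limit of functions \<open>f \<circ> r s\<close>, which belong
  to \<open>A\<close> by invariance.\<close>

lemma A_directed_limit:
  assumes \<Lambda>: "\<Lambda> \<subseteq> \<Gamma>" "up_directed \<Lambda> le" and f: "f \<in> A"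
  shows "(\<lambda>x\<in>K. f (directed_limit \<Lambda> x)) \<in> A"
proof (rule A_closed)
  fix e :: real assume "e > 0"
  then obtain s where s: "s \<in> \<Lambda>" "\<forall>x\<in>K. \<bar>f (r s x) - f (directed_limit \<Lambda> x)\<bar> < e"
    using comp_directed_limit_uniform[OF \<Lambda> A_continuous[OF f]] by blast
  with A_invariant[OF f, of s] \<Lambda>(1)
  show "\<exists>g\<in>A. \<forall>x\<in>K. \<bar>g x - (\<lambda>x\<in>K. f (directed_limit \<Lambda> x)) x\<bar> < e"
    by (intro bexI[of _ "\<lambda>x\<in>K. f (r s x)"]) auto
next
  show "continuous_on K (\<lambda>x\<in>K. f (directed_limit \<Lambda> x))"
    using comp_directed_limit_continuous[OF \<Lambda> A_continuous[OF f]] by (simp cong: continuous_on_cong)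
qed simp

text \<open>An element of the hull arises from finitely many generators, and the largest of those in
  \<open>L\<close> serves as \<open>e\<close>. The first alternative covers elements generated by
  \<open>b\<close> alone.\<close>

lemma join_hull_segment:
  assumes tr: "transp lt" and total: "\<And>a c. a \<in> \<Lambda> \<Longrightarrow> c \<in> \<Lambda> \<Longrightarrow> lt a c \<or> a = c \<or> lt c a"
    and L: "L \<subseteq> \<Lambda>" and s: "s \<in> join_hull L"
  shows "s \<in> join_hull {} \<or> (\<exists>e\<in>L. s \<in> join_hull {c\<in>\<Lambda>. c = e \<or> lt c e})"
  using s unfolding join_hull_def
proof induction
  case (generator s)
  with L show ?case
    by (auto intro!: binary_closure.generator)
next
  case (closed s t)
  let ?C = "\<lambda>e. binary_closure ub (insert b {c\<in>\<Lambda>. c = e \<or> lt c e})"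
  have mono: "?C d \<subseteq> ?C e" if "d = e \<or> lt d e" for d e
    using that tr by (intro binary_closure_mono) (auto dest: transpD)
  have mono0: "binary_closure ub {b} \<subseteq> ?C e" for e
    by (intro binary_closure_mono) auto
  \<comment> \<open>Of the end points belonging to \<open>s\<close> and \<open>t\<close>, the larger
    one works for both.\<close>
  consider "s \<in> binary_closure ub {b}" "t \<in> binary_closure ub {b}"
    | e where "e \<in> L" "s \<in> ?C e" "t \<in> ?C e"
  proof -
    have "d = e \<or> lt d e \<or> lt e d" if "d \<in> L" "e \<in> L" for d e
      using total that L by blast
    then show ?thesis
      using closed.IH that mono mono0 by (meson subsetD)
  qed
  then show ?case
    by cases (auto intro: binary_closure.closed)
qed

text \<open>At a first point of accumulation of jumps, the limit \<open>y\<close> of the orbit of \<open>x\<close> stays in \<open>D\<close>, so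
  countable tightness places \<open>y\<close> in the range of an earlier projection; the orbit is constant from
  there on.\<close>

lemma countable_jumps:
  assumes \<Lambda>: "\<Lambda> \<subseteq> \<Gamma>'" and wf: "wfP lt" and tr: "transp lt"
    and total: "\<And>a c. a \<in> \<Lambda> \<Longrightarrow> c \<in> \<Lambda> \<Longrightarrow> lt a c \<or> a = c \<or> lt c a"
    and x: "x \<in> D"
  shows "countable {a\<in>\<Lambda>. directed_limit (join_hull {c\<in>\<Lambda>. c = a \<or> lt c a}) x
                        \<noteq> directed_limit (join_hull {c\<in>\<Lambda>. lt c a}) x}" (is "countable ?J")
proof (rule ccontr)
  assume "uncountable ?J"
  then have "uncountable (?J \<inter> \<Lambda>)"
    by (simp add: Int_absorb2 subset_iff)
  \<comment> \<open>\<open>L\<close> has uncountably many jumps but only countably many below each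
    of its elements.\<close>
  then obtain L where L: "L \<subseteq> \<Lambda>" "\<And>a c. a \<in> L \<Longrightarrow> c \<in> \<Lambda> \<Longrightarrow> lt c a \<Longrightarrow> c \<in> L" "uncountable (?J \<inter> L)"
      "\<And>c. c \<in> L \<Longrightarrow> countable (?J \<inter> {a\<in>\<Lambda>. lt a c})"
    by (rule uncountable_initial_segment[OF wf tr]) blast+
  have L\<Gamma>: "L \<subseteq> \<Gamma>'" and seg\<Gamma>: "{c\<in>\<Lambda>. P c} \<subseteq> \<Gamma>'" for P
    using L(1) \<Lambda> by auto
  have xK: "x \<in> K"
    using x D_subset r_image_subset by (auto simp: induced_set_def)
  define y where "y = directed_limit (join_hull L) x"
  have yD: "y \<in> D"
    unfolding y_def using join_hull_in_\<Gamma>'[OF L\<Gamma>] join_hull_directed[OF L\<Gamma>] x by (rule directed_limit_in_D)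
  let ?B = "\<Union>s\<in>join_hull L. r s ` K"
  have "\<forall>\<^sub>F s in net_filter (join_hull L) le. r s x \<in> closure ?B"
    unfolding eventually_net_filter[OF join_hull_directed[OF L\<Gamma>] transp_on[OF join_hull_in_\<Gamma>[OF L\<Gamma>]]]
    using closure_subset[of ?B] xK join_hull_directed[OF L\<Gamma>] unfolding up_directed_def by blast
  then have "y \<in> closure ?B"
    unfolding y_def
    using tendsto_directed_limit[OF join_hull_in_\<Gamma>[OF L\<Gamma>] join_hull_directed[OF L\<Gamma>] xK]
    by (intro Lim_in_closed_set[OF closed_closure _
          net_filter_neq_bot[OF join_hull_directed[OF L\<Gamma>] transp_on[OF join_hull_in_\<Gamma>[OF L\<Gamma>]]]])
  moreover have "?B \<subseteq> induced_set K \<Gamma> r"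
    unfolding induced_set_def using join_hull_in_\<Gamma>[OF L\<Gamma>] by (rule UN_mono) simp
  moreover have "y \<in> induced_set K \<Gamma> r"
    using yD D_subset by blast
  ultimately obtain C where C: "countable C" "C \<subseteq> ?B" "y \<in> closure C"
    using induced_set_countable_tightness by metis
  have "L \<noteq> {}"
    using L(3) by auto
  then obtain e\<^sub>0 where e\<^sub>0: "e\<^sub>0 \<in> L" by blast
  have "\<exists>e\<in>L. s \<in> join_hull {c\<in>\<Lambda>. c = e \<or> lt c e}" if "s \<in> join_hull L" for s
    using join_hull_segment[OF tr total L(1) that] e\<^sub>0 join_hull_mono[OF empty_subsetI] by blast
  moreover have "\<forall>z\<in>C. \<exists>s\<in>join_hull L. z \<in> r s ` K"
    using C(2) by blast
  ultimately have "\<forall>z\<in>C. \<exists>p. z \<in> r (fst p) ` K \<and> snd p \<in> L \<and>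
      fst p \<in> join_hull {c\<in>\<Lambda>. c = snd p \<or> lt c (snd p)}"
    by (metis fst_conv snd_conv)
  from bchoice[OF this] obtain p where p: "\<forall>z\<in>C. z \<in> r (fst (p z)) ` K \<and> snd (p z) \<in> L \<and>
      fst (p z) \<in> join_hull {c\<in>\<Lambda>. c = snd (p z) \<or> lt c (snd (p z))}" ..
  define \<sigma> \<epsilon> where "\<sigma> z = fst (p z)" and "\<epsilon> z = snd (p z)" for z
  have \<sigma>: "\<And>z. z \<in> C \<Longrightarrow> z \<in> r (\<sigma> z) ` K" "\<And>z. z \<in> C \<Longrightarrow> \<epsilon> z \<in> L"
      "\<And>z. z \<in> C \<Longrightarrow> \<sigma> z \<in> join_hull {c\<in>\<Lambda>. c = \<epsilon> z \<or> lt c (\<epsilon> z)}"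
    using p by (simp_all add: \<sigma>_def \<epsilon>_def)
  \<comment> \<open>Only countably many jumps lie at or below some \<open>\<epsilon> z\<close>, so
    \<open>L\<close> contains a jump \<open>d\<close> above all of them.\<close>
  have "countable (\<Union>z\<in>C. ?J \<inter> {a\<in>\<Lambda>. lt a (\<epsilon> z)} \<union> {\<epsilon> z})"
    using C(1) L(4) \<sigma>(2) by (intro countable_UN countable_Un) auto
  then have "\<not> ?J \<inter> L \<subseteq> (\<Union>z\<in>C. ?J \<inter> {a\<in>\<Lambda>. lt a (\<epsilon> z)} \<union> {\<epsilon> z})"
    using L(3) countable_subset by blast
  then obtain d where d: "d \<in> ?J" "d \<in> L" "d \<notin> (\<Union>z\<in>C. ?J \<inter> {a\<in>\<Lambda>. lt a (\<epsilon> z)} \<union> {\<epsilon> z})"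
    by blast
  let ?M = "{c\<in>\<Lambda>. lt c d}" and ?P = "{c\<in>\<Lambda>. c = d \<or> lt c d}"
  have "C \<subseteq> (\<Union>s\<in>join_hull ?M. r s ` K)"
  proof
    fix z assume z: "z \<in> C"
    have "d \<in> \<Lambda>" "\<epsilon> z \<in> \<Lambda>"
      using d(2) \<sigma>(2)[OF z] L(1) by auto
    then have "lt (\<epsilon> z) d"
      using total[of "\<epsilon> z" d] d(1,3) z by blast
    then have "join_hull {c\<in>\<Lambda>. c = \<epsilon> z \<or> lt c (\<epsilon> z)} \<subseteq> join_hull ?M"
      using tr by (intro join_hull_mono) (auto dest: transpD)
    with \<sigma>(1,3)[OF z] show "z \<in> (\<Union>s\<in>join_hull ?M. r s ` K)" by blast
  qed
  moreover have MP: "join_hull ?M \<subseteq> join_hull ?P"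
    by (intro join_hull_mono) auto
  ultimately have CM: "C \<subseteq> (\<Union>s\<in>join_hull ?M. r s ` K)" and CP: "C \<subseteq> (\<Union>s\<in>join_hull ?P. r s ` K)"
    by blast+
  have PL: "join_hull ?P \<subseteq> join_hull L"
    using L(2) d(2) by (intro join_hull_mono) auto
  \<comment> \<open>The segment before \<open>d\<close> already generates indices fixing
    \<open>C\<close>, hence \<open>y\<close>. Absorption gives the value at \<open>x\<close> as the
    value at \<open>y\<close>, which is \<open>y\<close>. The same holds with \<open>d\<close>
    included, so \<open>d\<close> is no jump.\<close>
  have "directed_limit (join_hull ?M) x = y"
    using directed_limit_absorb[OF _ join_hull_in_\<Gamma>[OF L\<Gamma>] join_hull_directed join_hull_directed[OF L\<Gamma>] xK, of ?M]
      directed_limit_fixed_closure[OF join_hull_in_\<Gamma> join_hull_directed CM C(3)] MP PL seg\<Gamma>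
    by (simp add: y_def)
  moreover have "directed_limit (join_hull ?P) x = y"
    using directed_limit_absorb[OF PL join_hull_in_\<Gamma>[OF L\<Gamma>] join_hull_directed join_hull_directed[OF L\<Gamma>] xK]
      directed_limit_fixed_closure[OF join_hull_in_\<Gamma> join_hull_directed CP C(3)] seg\<Gamma>
    by (simp add: y_def)
  ultimately show False
    using d(1) by simp
qed

text \<open>The induction runs over sets closed under the hull: these are directed and contain the
  hulls of their initial segments. The invariance of \<open>h\<close> under the projection lets a
  larger index set take over the functions of a smaller one.\<close>

lemma point_countable_separating_family_hull:
  assumes "\<Lambda> \<subseteq> \<Gamma>'" "join_hull \<Lambda> = \<Lambda>"
  shows "\<exists>H\<subseteq>A. (\<forall>h\<in>H. \<forall>x\<in>K. h (directed_limit \<Lambda> x) = h x) \<and>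
    (\<forall>x\<in>K. \<forall>y\<in>K. directed_limit \<Lambda> x \<noteq> directed_limit \<Lambda> y \<longrightarrow> (\<exists>h\<in>H. h x \<noteq> h y)) \<and>
    (\<forall>x\<in>D. countable {h\<in>H. h x \<noteq> 0})"
proof -
  define good where "good L H \<longleftrightarrow> H \<subseteq> A \<and> (\<forall>h\<in>H. \<forall>x\<in>K. h (directed_limit L x) = h x) \<and>
    (\<forall>x\<in>K. \<forall>y\<in>K. directed_limit L x \<noteq> directed_limit L y \<longrightarrow> (\<exists>h\<in>H. h x \<noteq> h y)) \<and>
    (\<forall>x\<in>D. countable {h\<in>H. h x \<noteq> 0})" for L H
  have goodD: "H \<subseteq> A" "\<And>h x. h \<in> H \<Longrightarrow> x \<in> K \<Longrightarrow> h (directed_limit L x) = h x"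
      "\<And>x y. x \<in> K \<Longrightarrow> y \<in> K \<Longrightarrow> directed_limit L x \<noteq> directed_limit L y \<Longrightarrow> \<exists>h\<in>H. h x \<noteq> h y"
      "\<And>x. x \<in> D \<Longrightarrow> countable {h\<in>H. h x \<noteq> 0}"
    if "good L H" for L H
    using that unfolding good_def by blast+
  have "wf (inv_image ordLess (card_of :: 'b set \<Rightarrow> 'b rel))"
    by (intro wf_inv_image wf_ordLess)
  then have "\<Lambda> \<subseteq> \<Gamma>' \<longrightarrow> join_hull \<Lambda> = \<Lambda> \<longrightarrow> (\<exists>H. good \<Lambda> H)"
  proof (induction \<Lambda> rule: wf_induct_rule)
    case (less \<Lambda>)
    show ?case
    proof (intro impI)
      assume sub: "\<Lambda> \<subseteq> \<Gamma>'" and join_hull: "join_hull \<Lambda> = \<Lambda>"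
      have IH: "\<exists>H. good (join_hull S) H" if "S \<subseteq> \<Gamma>'" "|join_hull S| <o |\<Lambda>|" for S
        using less.IH[of "join_hull S"] that join_hull_in_\<Gamma>' join_hull_hull by simp
      have \<Lambda>: "\<Lambda> \<subseteq> \<Gamma>" "up_directed \<Lambda> le"
        using sub subset_\<Gamma> join_hull_directed[OF sub] join_hull by auto
      show "\<exists>H. good \<Lambda> H"
      proof (cases "countable \<Lambda>")
        case True
        obtain H where "H \<subseteq> A" "countable H"
          "\<And>h x. h \<in> H \<Longrightarrow> x \<in> K \<Longrightarrow> h (directed_limit \<Lambda> x) = h x"
          "\<And>x y. x \<in> K \<Longrightarrow> y \<in> K \<Longrightarrow> directed_limit \<Lambda> x \<noteq> directed_limit \<Lambda> y \<Longrightarrow> \<exists>h\<in>H. h x \<noteq> h y"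
          by (rule countable_separating_family[OF \<Lambda> True A_continuous A_separates A_invariant]) blast+
        then have "good \<Lambda> H"
          unfolding good_def by (intro conjI ballI impI countable_Collect) auto
        then show ?thesis ..
      next
        case False
        obtain lt where lt: "wfP lt" "transp lt"
          "\<And>a c. a \<in> \<Lambda> \<Longrightarrow> c \<in> \<Lambda> \<Longrightarrow> lt a c \<or> a = c \<or> lt c a"
          "\<And>a. a \<in> \<Lambda> \<Longrightarrow> |{c\<in>\<Lambda>. lt c a}| <o |\<Lambda>|"
          by (rule wellorder_with_small_segments[of \<Lambda>]) blast
        define M where "M a = {c\<in>\<Lambda>. lt c a}" for a
        define P where "P a = {c\<in>\<Lambda>. c = a \<or> lt c a}" for a
        have MP\<Gamma>: "M a \<subseteq> \<Gamma>'" "P a \<subseteq> \<Gamma>'" for a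
          using sub by (auto simp: M_def P_def)
        have join_hull\<Lambda>: "join_hull (M a) \<subseteq> \<Lambda>" "join_hull (P a) \<subseteq> \<Lambda>" "join_hull {} \<subseteq> \<Lambda>" for a
          by (rule join_hull_subset[OF _ sub join_hull], force simp: M_def P_def)+
        let ?R = directed_limit
        note RM = join_hull_in_\<Gamma>[OF MP\<Gamma>(1)] join_hull_directed[OF MP\<Gamma>(1)]
        note RP = join_hull_in_\<Gamma>[OF MP\<Gamma>(2)] join_hull_directed[OF MP\<Gamma>(2)]
        note R0 = join_hull_in_\<Gamma>[OF empty_subsetI] join_hull_directed[OF empty_subsetI]
        have "\<exists>H. good (join_hull (P a)) H" if a: "a \<in> \<Lambda>" for a
        proof (rule IH[OF MP\<Gamma>(2)])
          \<comment> \<open>The generators are a proper initial segment and two further points, so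
            the hull is smaller than the uncountable \<open>\<Lambda>\<close>.\<close>
          have "|binary_closure ub ({b, a} \<union> M a)| <o |\<Lambda>|"
            using lt(4)[OF a] False by (intro card_of_binary_closure_ordLess) (auto simp: M_def)
          moreover have "insert b (P a) = {b, a} \<union> M a"
            using a by (auto simp: P_def M_def)
          ultimately show "|join_hull (P a)| <o |\<Lambda>|"
            by (simp add: join_hull_def)
        qed
        then obtain F where F: "\<And>a. a \<in> \<Lambda> \<Longrightarrow> good (join_hull (P a)) (F a)"
          by metis
        have "\<exists>H. good (join_hull {}) H"
        proof (rule IH)
          have "|{} :: 'b set| <o |\<Lambda>|"
            using False countable_finite by (intro finite_card_of_ordLess) auto
          then show "|join_hull {}| <o |\<Lambda>|"
            unfolding join_hull_def using card_of_binary_closure_ordLess[of \<Lambda> "{}" "{b}" ub] False by simp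
        qed simp
        then obtain H\<^sub>0 where H\<^sub>0: "good (join_hull {}) H\<^sub>0"
          by blast
        \<comment> \<open>The increment of \<open>h\<close> between the stages \<open>M a\<close>
          and \<open>P a\<close>: since \<open>h\<close> in \<open>F a\<close> factors through the
          projection for \<open>P a\<close>, the increment vanishes wherever the two projections
          agree. The factor 1/2 keeps it in \<open>A\<close>.\<close>
        define \<phi> where "\<phi> a h = (\<lambda>x\<in>K. (h x - h (?R (join_hull (M a)) x)) / 2)" for a and h :: "'a \<Rightarrow> real"
        define H where "H = H\<^sub>0 \<union> (\<Union>a\<in>\<Lambda>. \<phi> a ` F a)"
        have absorb: "?R L (?R \<Lambda> x) = ?R L x" if "L \<subseteq> \<Lambda>" "up_directed L le" "x \<in> K" for L x
          using directed_limit_absorb[OF that(1) \<Lambda>(1) that(2) \<Lambda>(2) that(3)] .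
        have inA: "\<phi> a h \<in> A" if "a \<in> \<Lambda>" "h \<in> F a" for a h
        proof -
          have h: "h \<in> A" using goodD(1)[OF F] that by blast
          have "\<phi> a h = (\<lambda>x\<in>K. (h x - (\<lambda>x\<in>K. h (?R (join_hull (M a)) x)) x) / 2)"
            by (auto simp: \<phi>_def)
          then show ?thesis
            using A_half_diff[OF h A_directed_limit[OF RM h]] by simp
        qed
        have "H \<subseteq> A"
          using goodD(1)[OF H\<^sub>0] inA by (auto simp: H_def)
        moreover have "h (?R \<Lambda> x) = h x" if h: "h \<in> H" and x: "x \<in> K" for h x
        proof -
          have RK: "?R \<Lambda> x \<in> K"
            by (rule directed_limit_in_K[OF \<Lambda> x])
          have inv: "g (?R \<Lambda> x) = g x"
            if g: "\<forall>x\<in>K. g (?R L x) = g x" and L: "L \<subseteq> \<Lambda>" "up_directed L le" for g :: "'a \<Rightarrow> real" and L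
            using absorb[OF L x] g RK x by metis
          show ?thesis
          proof (cases "h \<in> H\<^sub>0")
            case True
            then show ?thesis
              using goodD(2)[OF H\<^sub>0] join_hull\<Lambda>(3) R0(2) by (intro inv[of h "join_hull {}"]) auto
          next
            case False
            then obtain a g where a: "a \<in> \<Lambda>" "g \<in> F a" "h = \<phi> a g"
              using h by (auto simp: H_def)
            have "g (?R \<Lambda> x) = g x"
              using goodD(2)[OF F[OF a(1)] a(2)] join_hull\<Lambda>(2) RP(2) by (intro inv[of g "join_hull (P a)"]) auto
            then show ?thesis
              using absorb[OF join_hull\<Lambda>(1) RM(2) x] RK x by (simp add: a(3) \<phi>_def)
          qed
        qed
        moreover have "\<exists>h\<in>H. h x \<noteq> h y" if xy: "x \<in> K" "y \<in> K" "?R \<Lambda> x \<noteq> ?R \<Lambda> y" for x y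
        proof (rule ccontr)
          assume "\<not> ?thesis"
          then have eq: "h x = h y" if "h \<in> H" for h
            using that by blast
          have eq0: "?R (join_hull {}) x = ?R (join_hull {}) y"
            using goodD(3)[OF H\<^sub>0 xy(1,2)] eq unfolding H_def by blast
          \<comment> \<open>Transfinite induction along \<open>lt\<close>: indices in the hull of
            \<open>M a\<close> belong to the hull of \<open>{}\<close> or of an earlier
            \<open>P e\<close>, where equality is known.\<close>
          have eqP: "a \<in> \<Lambda> \<longrightarrow> ?R (join_hull (P a)) x = ?R (join_hull (P a)) y" for a
            using lt(1)
          proof (induction a rule: wfp_induct_rule)
            case (less a)
            show ?case
            proof (intro impI)
              assume a: "a \<in> \<Lambda>"
              have "?R (join_hull (M a)) x = ?R (join_hull (M a)) y"
              proof (rule directed_limit_cong[OF RM xy(1,2)])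
                fix s assume s: "s \<in> join_hull (M a)"
                have "M a \<subseteq> \<Lambda>"
                  by (auto simp: M_def)
                from join_hull_segment[OF lt(2,3) this s]
                consider "s \<in> join_hull {}" | e where "e \<in> M a" "s \<in> join_hull (P e)"
                  unfolding P_def by blast
                then show "r s x = r s y"
                proof cases
                  case 1
                  then show ?thesis
                    using r_directed_limit[OF R0 xy(1) 1] r_directed_limit[OF R0 xy(2) 1] eq0 by simp
                next
                  case (2 e)
                  then have "?R (join_hull (P e)) x = ?R (join_hull (P e)) y"
                    using less.IH[of e] by (simp add: M_def)
                  then show ?thesis
                    using r_directed_limit[OF RP xy(1) 2(2)] r_directed_limit[OF RP xy(2) 2(2)] by simp
                qed
              qed
              \<comment> \<open>The increments agree at \<open>x\<close> and \<open>y\<close> since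
                they lie in \<open>H\<close>, and the subtracted terms agree by the equality for
                \<open>M a\<close>.\<close>
              moreover have "h x = h y" if "h \<in> F a"
                "?R (join_hull (M a)) x = ?R (join_hull (M a)) y" for h
                using eq[of "\<phi> a h"] a that xy(1,2) by (auto simp: H_def \<phi>_def)
              ultimately show "?R (join_hull (P a)) x = ?R (join_hull (P a)) y"
                using goodD(3)[OF F[OF a] xy(1,2)] by blast
            qed
          qed
          have "?R \<Lambda> x = ?R \<Lambda> y"
          proof (rule directed_limit_cong[OF \<Lambda> xy(1,2)])
            fix s assume s: "s \<in> \<Lambda>"
            then have "s \<in> P s"
              by (simp add: P_def)
            then have sP: "s \<in> join_hull (P s)"
              by (rule subsetD[OF join_hull_superset])
            show "r s x = r s y"
              using r_directed_limit[OF RP xy(1) sP] r_directed_limit[OF RP xy(2) sP] eqP[of s] s by simp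
          qed
          with xy(3) show False by simp
        qed
        moreover have "countable {h\<in>H. h x \<noteq> 0}" if x: "x \<in> D" for x
        proof -
          have xK: "x \<in> K"
            using x D_subset r_image_subset by (auto simp: induced_set_def)
          define J where "J = {a\<in>\<Lambda>. ?R (join_hull (P a)) x \<noteq> ?R (join_hull (M a)) x}"
          have cJ: "countable J"
            unfolding J_def P_def M_def by (rule countable_jumps[OF sub lt(1-3) x])
          let ?Z = "\<lambda>a z. {h\<in>F a. h z \<noteq> 0}"
          \<comment> \<open>An increment nonzero at \<open>x\<close> comes from a jump
            \<open>a\<close> and from a \<open>g\<close> nonzero at \<open>x\<close> or at its
            projection for \<open>M a\<close>. Both points lie in \<open>D\<close>, so each stage
            contributes countably many.\<close>
          let ?W = "\<lambda>a. ?Z a x \<union> ?Z a (?R (join_hull (M a)) x)"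
          have "countable (?W a)" if "a \<in> \<Lambda>" for a
            using goodD(4)[OF F[OF that]] x directed_limit_in_D[OF join_hull_in_\<Gamma>'[OF MP\<Gamma>(1)] RM(2) x]
            by (intro countable_Un) auto
          then have "countable ({h\<in>H\<^sub>0. h x \<noteq> 0} \<union> (\<Union>a\<in>J. \<phi> a ` ?W a))"
            using goodD(4)[OF H\<^sub>0] x cJ by (intro countable_Un countable_UN countable_image) (auto simp: J_def)
          moreover have "{h\<in>H. h x \<noteq> 0} \<subseteq> {h\<in>H\<^sub>0. h x \<noteq> 0} \<union> (\<Union>a\<in>J. \<phi> a ` ?W a)"
          proof
            fix h assume h: "h \<in> {h\<in>H. h x \<noteq> 0}"
            show "h \<in> {h\<in>H\<^sub>0. h x \<noteq> 0} \<union> (\<Union>a\<in>J. \<phi> a ` ?W a)"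
            proof (cases "h \<in> H\<^sub>0")
              case True
              with h show ?thesis by blast
            next
              case False
              then obtain a g where a: "a \<in> \<Lambda>" "g \<in> F a" "h = \<phi> a g"
                using h by (auto simp: H_def)
              have neq: "g x \<noteq> g (?R (join_hull (M a)) x)"
                using h xK by (auto simp: a(3) \<phi>_def)
              moreover have "g (?R (join_hull (P a)) x) = g x"
                by (rule goodD(2)[OF F[OF a(1)] a(2) xK])
              ultimately have "a \<in> J"
                using a(1) by (auto simp: J_def)
              moreover have "g \<in> ?W a"
                using neq a(2) by auto
              ultimately show ?thesis
                using a(3) by blast
            qed
          qed
          ultimately show ?thesis
            by (rule countable_subset[rotated])
        qed
        ultimately have "good \<Lambda> H"
          unfolding good_def by (intro conjI ballI impI) simp_all
        then show ?thesis ..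
      qed
    qed
  qed
  with assms obtain H where "good \<Lambda> H" by blast
  then show ?thesis
    unfolding good_def by (intro exI[of _ H]) simp
qed

end

unbundle no cardinal_syntax

section \<open>Embeddings into Sigma-spaces\<close>

lemma in_mcball_C_space_iff:
  assumes "compact K" "c \<ge> 0"
  shows "f \<in> mcball_of (C_space K) (\<lambda>x\<in>K. 0) c \<longleftrightarrow>
    f \<in> extensional K \<and> continuous_on K f \<and> (\<forall>x\<in>K. \<bar>f x\<bar> \<le> c)"
proof -
  have mspace: "g \<in> mspace (C_space K) \<longleftrightarrow> g \<in> extensional K \<and> continuous_on K g" for g
    using assms(1) by (subst compactin_mspace_cfunspace) auto
  have zero: "(\<lambda>x\<in>K. 0) \<in> mspace (C_space K)"
    unfolding mspace by (simp cong: continuous_on_cong)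
  have "mdist (C_space K) (\<lambda>x\<in>K. 0) f \<le> c \<longleftrightarrow> (\<forall>x\<in>K. \<bar>f x\<bar> \<le> c)" if f: "f \<in> mspace (C_space K)"
  proof
    assume "mdist (C_space K) (\<lambda>x\<in>K. 0) f \<le> c"
    from mdist_cfunspace_imp_mdist_le[OF zero f this] show "\<forall>x\<in>K. \<bar>f x\<bar> \<le> c"
      by (auto simp: dist_real_def)
  next
    assume "\<forall>x\<in>K. \<bar>f x\<bar> \<le> c"
    then show "mdist (C_space K) (\<lambda>x\<in>K. 0) f \<le> c"
      by (intro mdist_cfunspace_le[OF assms(2)]) (auto simp: dist_real_def)
  qed
  with zero show ?thesis
    unfolding in_mcball_of mspace by blast
qed

text \<open>Translates closedness in \<open>C(K)\<close> into closedness under uniform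
  approximation: a function outside \<open>A\<close> would have a ball disjoint from
  \<open>A\<close>.\<close>

lemma closedin_C_spaceD:
  assumes K: "compact K" and A: "closedin (mtopology_of (C_space K)) A"
    and f: "f \<in> extensional K" "continuous_on K f"
    and approx: "\<And>e. e > 0 \<Longrightarrow> \<exists>g\<in>A. \<forall>x\<in>K. \<bar>g x - f x\<bar> < e"
  shows "f \<in> A"
proof (rule ccontr)
  interpret M: Metric_space "mspace (C_space K)" "mdist (C_space K)"
    by (rule Metric_space_mspace_mdist)
  assume "f \<notin> A"
  moreover have fM: "f \<in> mspace (C_space K)"
    using K f by (subst compactin_mspace_cfunspace) auto
  moreover have AM: "A \<subseteq> mspace (C_space K)"
    and cl: "\<And>g. g \<in> mspace (C_space K) - A \<Longrightarrow> \<exists>e>0. disjnt A (M.mball g e)"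
    using A unfolding mtopology_of_def M.closedin_metric by blast+
  ultimately obtain e where e: "e > 0" "disjnt A (M.mball f e)"
    by blast
  \<comment> \<open>Pointwise bounds give only a weak inequality for the distance;
    \<open>e / 2\<close> makes it strict against \<open>e\<close>.\<close>
  obtain g where g: "g \<in> A" "\<forall>x\<in>K. \<bar>g x - f x\<bar> < e / 2"
    using approx[of "e / 2"] e(1) by auto
  have "mdist (C_space K) f g \<le> e / 2"
    using g(2) e(1) by (intro mdist_cfunspace_le) (auto simp: dist_real_def abs_minus_commute less_imp_le)
  then have "g \<in> M.mball f e"
    using fM AM g(1) e(1) by (auto simp del: mspace_cfunspace)
  with e(2) g(1) show False
    by (auto simp: disjnt_def)
qed

text \<open>A continuous injection of a compact space into a Hausdorff cube is an embedding, so the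
  embedding condition reduces to separation of points. Dividing by \<open>c\<close> puts the values
  into \<open>[-1, 1]\<close> without changing supports.\<close>

lemma Sigma_embedding_iff_point_countable:
  fixes K D :: "'a::t2_space set" and A :: "('a \<Rightarrow> real) set"
  assumes K: "compact K" and c: "c \<ge> 1" and A: "A \<subseteq> mcball_of (C_space K) (\<lambda>x\<in>K. 0) c"
  shows "has_Sigma_embedding K D c A \<longleftrightarrow>
    (\<exists>H\<subseteq>A. (\<forall>x\<in>K. \<forall>y\<in>K. x \<noteq> y \<longrightarrow> (\<exists>h\<in>H. h x \<noteq> h y)) \<and> (\<forall>x\<in>D. countable {h\<in>H. h x \<noteq> 0}))"
proof -
  have Acont: "continuous_on K h" and Abound: "x \<in> K \<Longrightarrow> \<bar>h x\<bar> \<le> c" if "h \<in> A" for h x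
    using A that in_mcball_C_space_iff[OF K, of c h] c by auto
  have emb: "embedding_map (top_of_set K) (product_topology (\<lambda>_. top_of_set {-1..1}) H) (evaluation_map c H) \<longleftrightarrow>
      (\<forall>x\<in>K. \<forall>y\<in>K. x \<noteq> y \<longrightarrow> (\<exists>h\<in>H. h x \<noteq> h y))" (is "?emb \<longleftrightarrow> ?sep") if H: "H \<subseteq> A" for H
  proof
    assume ?emb
    then have "inj_on (evaluation_map c H) K"
      unfolding embedding_map_def using homeomorphic_imp_injective_map by fastforce
    moreover have "evaluation_map c H x = evaluation_map c H y" if "\<forall>h\<in>H. h x = h y" for x y
      using that by (auto simp: evaluation_map_def)
    ultimately show ?sep
      unfolding inj_on_def by metis
  next
    assume sep: ?sep
    have "continuous_map (top_of_set K) (top_of_set {-1..1}) (\<lambda>x. 1 / c * h x)" if h: "h \<in> H" for h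
    proof -
      have "continuous_on K (\<lambda>x. 1 / c * h x)"
        using Acont[of h] H h by (intro continuous_intros) auto
      moreover have "1 / c * h x \<in> {-1..1}" if "x \<in> K" for x
        using Abound[of h x] H h that c by (auto simp: abs_le_iff field_simps)
      ultimately show ?thesis
        by (auto simp: continuous_map_in_subtopology)
    qed
    then have "continuous_map (top_of_set K) (product_topology (\<lambda>_. top_of_set {-1..1}) H) (evaluation_map c H)"
      unfolding continuous_map_componentwise by (auto simp: evaluation_map_def)
    moreover have "compact_space (top_of_set K)"
      using K by (simp add: compact_space_subtopology)
    moreover have "Hausdorff_space (product_topology (\<lambda>_. top_of_set {-1..1::real}) H)"
      by (simp add: Hausdorff_space_product_topology Hausdorff_space_subtopology)
    moreover have "inj_on (evaluation_map c H) (topspace (top_of_set K))"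
    proof (rule inj_onI)
      fix x y assume xy: "x \<in> topspace (top_of_set K)" "y \<in> topspace (top_of_set K)"
        and eq: "evaluation_map c H x = evaluation_map c H y"
      have "h x = h y" if "h \<in> H" for h
        using fun_cong[OF eq, of h] that c by (simp add: evaluation_map_def)
      with sep xy show "x = y" by auto
    qed
    ultimately show ?emb
      by (rule continuous_imp_embedding_map)
  qed
  have sig: "evaluation_map c H ` D \<subseteq> Sigma_space H \<longleftrightarrow> (\<forall>x\<in>D. countable {h\<in>H. h x \<noteq> 0})" for H
  proof -
    have "{h\<in>H. evaluation_map c H x h \<noteq> 0} = {h\<in>H. h x \<noteq> 0}" for x
      using c by (auto simp: evaluation_map_def)
    moreover have "evaluation_map c H x \<in> H \<rightarrow>\<^sub>E UNIV" for x
      by (auto simp: evaluation_map_def)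
    ultimately show ?thesis
      by (simp add: Sigma_space_def image_subset_iff)
  qed
  show ?thesis
    unfolding has_Sigma_embedding_def sig by (rule ex_cong1, rule conj_cong[OF refl], simp only: emb)
qed

context compact_skeleton
begin

text \<open>The separating family is taken for \<open>\<Lambda> = \<Gamma>'\<close>, whose limit
  projection is the identity. Point-countability extends from the dense set \<open>D\<close> to the
  induced set by countable tightness.\<close>

lemma limit_closed_imp_Sigma_embedding:
  assumes lc: "has_subskeleton_with_limit_closed_dense_set K \<Gamma> le r"
    and c: "c \<ge> 1" and A: "A \<subseteq> mcball_of (C_space K) (\<lambda>x\<in>K. 0) c"
    and closed: "closedin (mtopology_of (C_space K)) A"
    and symmetric: "symmetric_fun_set K A" and convex: "convex_fun_set K A"
    and sep: "separates_points K A" and inv: "\<forall>f\<in>A. \<forall>s\<in>\<Gamma>. (\<lambda>x\<in>K. f (r s x)) \<in> A"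
  shows "has_Sigma_embedding K (induced_set K \<Gamma> r) c A"
proof -
  obtain \<Gamma>' D where \<Gamma>': "subskeleton_index \<Gamma> le \<Gamma>'" and D: "D \<subseteq> induced_set K \<Gamma> r" "K \<subseteq> closure D"
    and lim: "\<And>\<Lambda> x. \<Lambda> \<subseteq> \<Gamma>' \<Longrightarrow> up_directed \<Lambda> le \<Longrightarrow> x \<in> D \<Longrightarrow>
        \<exists>y\<in>D. ((\<lambda>s. r s x) \<longlongrightarrow> y) (net_filter \<Lambda> le)"
    using lc unfolding has_subskeleton_with_limit_closed_dense_set_def by metis
  have dir: "up_directed \<Gamma>' le"
    using subskeleton_directed[OF \<Gamma>'] .
  then obtain b where b: "b \<in> \<Gamma>'"
    by (auto simp: up_directed_def)
  have "\<forall>s t. \<exists>u. s \<in> \<Gamma>' \<longrightarrow> t \<in> \<Gamma>' \<longrightarrow> u \<in> \<Gamma>' \<and> le s u \<and> le t u"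
    using dir unfolding up_directed_def by blast
  then obtain ub where ub: "\<And>s t. s \<in> \<Gamma>' \<Longrightarrow> t \<in> \<Gamma>' \<Longrightarrow> ub s t \<in> \<Gamma>' \<and> le s (ub s t) \<and> le t (ub s t)"
    by metis
  have Acont: "continuous_on K f" if "f \<in> A" for f
    using A that in_mcball_C_space_iff[OF compact_K, of c f] c by auto
  have half: "(\<lambda>x\<in>K. (f x - g x) / 2) \<in> A" if fg: "f \<in> A" "g \<in> A" for f g
  proof -
    have "(\<lambda>x\<in>K. - g x) \<in> A"
      using symmetric fg(2) by (simp add: symmetric_fun_set_def)
    \<comment> \<open>The half-difference is the midpoint of \<open>f\<close> and
      \<open>- g\<close>.\<close>
    then have "(\<lambda>x\<in>K. (1 - 1/2) * f x + 1/2 * (\<lambda>x\<in>K. - g x) x) \<in> A"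
      using convex fg(1) unfolding convex_fun_set_def by fastforce
    moreover have "(\<lambda>x\<in>K. (1 - 1/2) * f x + 1/2 * (\<lambda>x\<in>K. - g x) x) = (\<lambda>x\<in>K. (f x - g x) / 2)"
      by (auto simp: fun_eq_iff field_simps)
    ultimately show ?thesis by simp
  qed
  have sep': "\<exists>f\<in>A. f x \<noteq> f y" if "x \<in> K" "y \<in> K" "x \<noteq> y" for x y
    using sep that by (simp add: separates_points_def)
  have inv': "(\<lambda>x\<in>K. f (r s x)) \<in> A" if "f \<in> A" "s \<in> \<Gamma>" for f s
    using inv that by blast
  interpret limit_closed_skeleton K \<Gamma> le r \<Gamma>' D A ub b
    by unfold_locales (fact \<Gamma>' D(1) lim ub b Acont sep' inv' half closedin_C_spaceD[OF compact_K closed])+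
  have "join_hull \<Gamma>' = \<Gamma>'"
    using join_hull_in_\<Gamma>'[OF order_refl] join_hull_superset by blast
  then obtain H where H: "H \<subseteq> A" "\<forall>x\<in>K. \<forall>y\<in>K. directed_limit \<Gamma>' x \<noteq> directed_limit \<Gamma>' y \<longrightarrow> (\<exists>h\<in>H. h x \<noteq> h y)"
      "\<forall>x\<in>D. countable {h\<in>H. h x \<noteq> 0}"
    using point_countable_separating_family_hull[OF order_refl] by blast
  have "countable {h\<in>H. h x \<noteq> 0}" if x: "x \<in> induced_set K \<Gamma> r" for x
  proof -
    have xK: "x \<in> K"
      using x r_image_subset by (auto simp: induced_set_def)
    obtain C where C: "countable C" "C \<subseteq> D" "x \<in> closure C"
      by (rule induced_set_countable_tightness[OF D(1) x]) (use xK D(2) in blast)+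
    have CK: "C \<subseteq> K"
      using C(2) D(1) r_image_subset unfolding induced_set_def by blast
    \<comment> \<open>A function nonzero at \<open>x\<close> is nonzero somewhere on the countable
      \<open>C\<close>, because \<open>x\<close> lies in its closure.\<close>
    have "{h\<in>H. h x \<noteq> 0} \<subseteq> (\<Union>z\<in>C. {h\<in>H. h z \<noteq> 0})"
    proof (rule subsetI, rule ccontr)
      fix h assume h: "h \<in> {h\<in>H. h x \<noteq> 0}" "h \<notin> (\<Union>z\<in>C. {h\<in>H. h z \<noteq> 0})"
      have hA: "h \<in> A"
        using h(1) H(1) by blast
      have "h x = 0"
      proof (rule eq_on_closure[where g = "\<lambda>_. 0", OF closed_K A_continuous[OF hA] continuous_on_const CK _ C(3)])
        show "h z = 0" if "z \<in> C" for z
          using that h by blast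
      qed
      with h(1) show False by simp
    qed
    moreover have "countable (\<Union>z\<in>C. {h\<in>H. h z \<noteq> 0})"
      using C(1,2) H(3) by (intro countable_UN) auto
    ultimately show ?thesis
      by (rule countable_subset)
  qed
  moreover have "\<forall>x\<in>K. \<forall>y\<in>K. x \<noteq> y \<longrightarrow> (\<exists>h\<in>H. h x \<noteq> h y)"
    using H(2) directed_limit_subskeleton[OF \<Gamma>'] by simp
  ultimately show ?thesis
    unfolding Sigma_embedding_iff_point_countable[OF compact_K c A] using H(1) by blast
qed

lemma Sigma_embedding_imp_commutative:
  assumes c: "c \<ge> 1" and A: "A \<subseteq> mcball_of (C_space K) (\<lambda>x\<in>K. 0) c"
    and "has_Sigma_embedding K (induced_set K \<Gamma> r) c A"
  shows "has_commutative_subskeleton K \<Gamma> le r"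
proof -
  obtain H where H: "H \<subseteq> A" "\<forall>x\<in>K. \<forall>y\<in>K. x \<noteq> y \<longrightarrow> (\<exists>h\<in>H. h x \<noteq> h y)"
      "\<forall>x\<in>induced_set K \<Gamma> r. countable {h\<in>H. h x \<noteq> 0}"
    using assms(3) unfolding Sigma_embedding_iff_point_countable[OF compact_K c A] by blast
  show ?thesis
  proof (rule point_countable_imp_commutative)
    show "continuous_on K h" if "h \<in> H" for h
      using that H(1) A in_mcball_C_space_iff[OF compact_K, of c h] c by auto
  qed (use H(2,3) in blast)+
qed

text \<open>The closed unit ball of \<open>C(K)\<close> meets all requirements on \<open>A\<close>
  with \<open>c = 1\<close>; the resulting Sigma-embedding yields the commutative
  subskeleton.\<close>

lemma limit_closed_imp_commutative:
  assumes "has_subskeleton_with_limit_closed_dense_set K \<Gamma> le r"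
  shows "has_commutative_subskeleton K \<Gamma> le r"
proof -
  let ?B = "mcball_of (C_space K) (\<lambda>x\<in>K. 0) 1"
  note B = in_mcball_C_space_iff[OF compact_K zero_le_one]
  interpret M: Metric_space "mspace (C_space K)" "mdist (C_space K)"
    by (rule Metric_space_mspace_mdist)
  have "closedin (mtopology_of (C_space K)) ?B"
    unfolding mtopology_of_def mcball_of_def by (rule M.closedin_mcball)
  moreover have "symmetric_fun_set K ?B"
    unfolding symmetric_fun_set_def
  proof (rule ballI)
    fix f assume "f \<in> ?B"
    then show "(\<lambda>x\<in>K. - f x) \<in> ?B"
      unfolding B by (auto intro!: continuous_intros cong: continuous_on_cong)
  qed
  moreover have "convex_fun_set K ?B"
    unfolding convex_fun_set_def
  proof (intro ballI)
    fix f g and t :: real assume fg: "f \<in> ?B" "g \<in> ?B" and t: "t \<in> {0..1}"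
    have "\<bar>(1 - t) * f x + t * g x\<bar> \<le> 1" if x: "x \<in> K" for x
    proof -
      have "\<bar>(1 - t) * f x + t * g x\<bar> \<le> (1 - t) * \<bar>f x\<bar> + t * \<bar>g x\<bar>"
        using abs_triangle_ineq[of "(1 - t) * f x" "t * g x"] t by (simp add: abs_mult)
      also have "\<dots> \<le> (1 - t) * 1 + t * 1"
        using fg t x unfolding B by (intro add_mono mult_left_mono) auto
      finally show ?thesis by simp
    qed
    moreover have "continuous_on K (\<lambda>x. (1 - t) * f x + t * g x)"
      using fg unfolding B by (intro continuous_intros) auto
    ultimately show "(\<lambda>x\<in>K. (1 - t) * f x + t * g x) \<in> ?B"
      unfolding B by (simp cong: continuous_on_cong)
  qed
  moreover have "separates_points K ?B"
    unfolding separates_points_def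
  proof (intro ballI impI)
    fix x y assume xy: "x \<in> K" "y \<in> K" "x \<noteq> y"
    obtain f :: "'a \<Rightarrow> real" where f: "continuous_on K f" "f ` K \<subseteq> {0..1}" "f x \<noteq> f y"
      by (rule compact_Urysohn_separate[OF compact_K xy]) blast
    have "(\<lambda>x\<in>K. f x) \<in> ?B"
      unfolding B using f(1,2) by (auto cong: continuous_on_cong)
    with f(3) xy show "\<exists>f\<in>?B. f x \<noteq> f y"
      by (intro bexI[of _ "\<lambda>x\<in>K. f x"]) simp_all
  qed
  moreover have "\<forall>f\<in>?B. \<forall>s\<in>\<Gamma>. (\<lambda>x\<in>K. f (r s x)) \<in> ?B"
  proof (intro ballI)
    fix f s assume "f \<in> ?B" "s \<in> \<Gamma>"
    then show "(\<lambda>x\<in>K. f (r s x)) \<in> ?B"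
      unfolding B using comp_r_continuous[of f s] r_in_K[of s] by (simp cong: continuous_on_cong)
  qed
  ultimately have "has_Sigma_embedding K (induced_set K \<Gamma> r) 1 ?B"
    by (intro limit_closed_imp_Sigma_embedding[OF assms]) auto
  then show ?thesis
    by (intro Sigma_embedding_imp_commutative[of 1 ?B]) auto
qed

end

text \<open>Condition (i) is an equivalence for the index type of \<open>\<Gamma>\<close>, where a
  commutative subskeleton lives. Its implication to (ii) is stated for an arbitrary further index
  type \<open>'c\<close>.\<close>

theorem theorem4:
  fixes K :: "'a::t2_space set"
    and \<Gamma> :: "'b set" and le :: "'b \<Rightarrow> 'b \<Rightarrow> bool" and r :: "'b \<Rightarrow> 'a \<Rightarrow> 'a"
  assumes "compact K"
    and "retractional_skeleton K \<Gamma> le r"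
  shows
    "(induced_by_commutative_skeleton TYPE('b) K (induced_set K \<Gamma> r) \<longleftrightarrow>
        has_commutative_subskeleton K \<Gamma> le r) \<and>
     (induced_by_commutative_skeleton TYPE('c) K (induced_set K \<Gamma> r) \<longrightarrow>
        has_commutative_subskeleton K \<Gamma> le r) \<and>
     (has_commutative_subskeleton K \<Gamma> le r \<longleftrightarrow>
        has_subskeleton_with_limit_closed_dense_set K \<Gamma> le r) \<and>
     (\<forall>(c::real) A. c \<ge> 1 \<and>
        A \<subseteq> mcball_of (C_space K) (\<lambda>x\<in>K. 0) c \<and>
        closedin (mtopology_of (C_space K)) A \<and>
        symmetric_fun_set K A \<and> convex_fun_set K A \<and> separates_points K A \<and>
        (\<forall>f\<in>A. \<forall>s\<in>\<Gamma>. (\<lambda>x\<in>K. f (r s x)) \<in> A) \<longrightarrow>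
        (has_commutative_subskeleton K \<Gamma> le r \<longleftrightarrow>
           has_Sigma_embedding K (induced_set K \<Gamma> r) c A))"
proof -
  interpret compact_skeleton K \<Gamma> le r
    using assms by unfold_locales
  have "induced_by_commutative_skeleton TYPE('b) K (induced_set K \<Gamma> r) \<longleftrightarrow>
      has_commutative_subskeleton K \<Gamma> le r"
    using commutative_subskeleton_imp_induced induced_by_commutative_imp_subskeleton by (rule iffI[rotated])
  moreover have "induced_by_commutative_skeleton TYPE('c) K (induced_set K \<Gamma> r) \<longrightarrow>
      has_commutative_subskeleton K \<Gamma> le r"
    by (intro impI induced_by_commutative_imp_subskeleton)
  moreover have "has_commutative_subskeleton K \<Gamma> le r \<longleftrightarrow>
      has_subskeleton_with_limit_closed_dense_set K \<Gamma> le r"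
    using commutative_imp_limit_closed limit_closed_imp_commutative by (rule iffI)
  \<comment> \<open>The forward direction passes through (iii), the backward one through
    point-countability of the embedding's coordinates.\<close>
  moreover have "has_commutative_subskeleton K \<Gamma> le r \<longleftrightarrow> has_Sigma_embedding K (induced_set K \<Gamma> r) c A"
    if "c \<ge> 1" "A \<subseteq> mcball_of (C_space K) (\<lambda>x\<in>K. 0) c" "closedin (mtopology_of (C_space K)) A"
      "symmetric_fun_set K A" "convex_fun_set K A" "separates_points K A"
      "\<forall>f\<in>A. \<forall>s\<in>\<Gamma>. (\<lambda>x\<in>K. f (r s x)) \<in> A" for c A
    using limit_closed_imp_Sigma_embedding[OF commutative_imp_limit_closed that]
      Sigma_embedding_imp_commutative[OF that(1,2)] by (rule iffI)
  ultimately show ?thesis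
    by simp
qed

end
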